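(* In the following, sums over $\mu$ are over all integer partitions. (i) For all integers $k_1,k_2\ge0$, $\sum_\mu a_{k_1+\frac12}(\mu)a_{k_2}(\mu)$ is the number of set partitions of $[k_1+k_2+1]$ such that $\min(X)\le k_1+1\le\max(X)$ for all blocks $X$, and $k_1+1$ is the maximal element in its block. Moreover $$\sum_\mu a_{k_1+\frac12}(\mu)a_{k_2}(\mu)=\sum_{j\ge0}j!\,S(k_1+1,j+1)S(k_2,j).$$ (ii) For all integers $k_1\ge1$ and $k_2\ge0$, $\sum_\mu g_{k_1}(\mu)a_{k_2}(\mu)=\sum_\mu g_{k_1-\frac12}(\mu)a_{k_2+\frac12}(\mu)$ is the number of set partitions of $[k_1+k_2]$ such that $\min(X)\le k_1$ for all blocks $X$. Moreover $$\sum_\mu g_{k_1}(\mu)a_{k_2}(\mu)=\sum_\mu g_{k_1-\frac12}(\mu)a_{k_2+\frac12}(\mu)=\sum_{j\ge0}j!\,B(k_1,j)S(k_2,j)=\sum_{j\ge0}j!\,\tilde B(k_1,j)S(k_2+1,j+1).$$ (iii) For all integers $k_1,k_2\ge0$, $\sum_\mu g_{k_1+\frac12}(\mu)a_{k_2}(\mu)$ is the number of set partitions of $[k_1+k_2+1]$ such that $\min(X)\le k_1+1$ for all blocks $X$, and $k_1+1$ is the maximal element in its block. Moreover $$\sum_\mu g_{k_1+\frac12}(\mu)a_{k_2}(\mu)=\sum_{j\ge0}j!\,\tilde B(k_1+1,j)S(k_2,j).$$ (iv) For all integers $k_1,k_2\ge0$, $\sum_\mu g_{k_1}(\mu)a_{k_2+\frac12}(\mu)$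 is the number of set partitions of $[k_1+k_2+1]$ such that $\min(X)\le k_1+1$ for all blocks $X$, and $k_1+1$ is the minimal element in its block. Moreover $$\sum_\mu g_{k_1}(\mu)a_{k_2+\frac12}(\mu)=\sum_{j\ge0}j!\,B(k_1,j)S(k_2+1,j+1).$$
   Context: $[k]=\{1,2,\dots,k\}$. Integer partitions are identified with their Young diagrams and ordered by containment; $\emptyset$ is the only partition of $0$. A simplified vacillating tableau of shape $\mu$ and length $2k$ (respectively $2k+1$) is a sequence of integer partitions $(\mu^{(0)}=\emptyset,\mu^{(1/2)},\mu^{(1)},\mu^{(3/2)},\dots)$ ending at $\mu^{(k)}=\mu$ (respectively at $\mu^{(k+1/2)}=\mu$) such that for every integer $j\ge0$ for which the partitions involved occur in the sequence: (a) $\mu^{(j)}\supseteq\mu^{(j+1/2)}$ and $|\mu^{(j)}/\mu^{(j+1/2)}|\in\{0,1\}$; (b) $\mu^{(j+1/2)}\subseteq\mu^{(j+1)}$ and $|\mu^{(j+1)}/\mu^{(j+1/2)}|\in\{0,1\}$. A limiting vacillating tableau is one for which in (b) always $|\mu^{(j+1)}/\mu^{(j+1/2)}|=1$. $g_k(\mu)$ and $g_{k+\frac12}(\mu)$ are the numbers of simplified vacillating tableaux of shape $\mu$ of lengths $2k$ and $2k+1$; $a_k(\mu)$ and $a_{k+\frac12}(\mu)$ are the numbers of limiting vacillating tableaux of shape $\mu$ of lengths $2k$ and $2k+1$. $S(k,j)$ is the Stirling number of the second kind, with $S(0,0)=1$, $S(0,j)=0$ for $j\ge1$. $B(k,j)$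 is the number of pairs $(\boldsymbol{B},A)$ where $\boldsymbol{B}$ is a set partition of $[k]$ and $A$ is a set of exactly $j$ blocks of $\boldsymbol{B}$ (so $B(k,j)=\sum_r\binom rj S(k,r)$). For $k\ge1$, $\tilde B(k,j)$ is the number of such pairs for which no block in $A$ contains $k$ (so $\tilde B(k+1,j)=\sum_r\binom rj S(k+1,r+1)$ for $k\ge0$). *)

theory Defs
  imports
    "HOL-Analysis.Infinite_Sum"
    "HOL-Combinatorics.Stirling"
    "HOL-Library.Disjoint_Sets"
begin

definition int_partition :: "nat list \<Rightarrow> bool" where
  "int_partition \<mu> \<longleftrightarrow> sorted_wrt (\<ge>) \<mu> \<and> (\<forall>p\<in>set \<mu>. p > 0)"

definition diagram :: "nat list \<Rightarrow> (nat \<times> nat) set" where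
  "diagram \<mu> = {(i, j). i < length \<mu> \<and> j < \<mu> ! i}"

text \<open>The entry \<open>T ! i\<close> of a tableau is the partition with superscript \<open>i / 2\<close>, so a tableau of
  length \<open>n\<close> is a list of \<open>n + 1\<close> partitions.\<close>

definition simplified_vacillating_tableau :: "nat \<Rightarrow> nat list \<Rightarrow> nat list list \<Rightarrow> bool" where
  "simplified_vacillating_tableau n \<mu> T \<longleftrightarrow>
     length T = n + 1 \<and> (\<forall>\<nu>\<in>set T. int_partition \<nu>) \<and> T ! 0 = [] \<and> T ! n = \<mu> \<and>
     (\<forall>j. 2 * j + 1 \<le> n \<longrightarrow>
        diagram (T ! (2 * j + 1)) \<subseteq> diagram (T ! (2 * j)) \<and>
        card (diagram (T ! (2 * j)) - diagram (T ! (2 * j + 1))) \<in> {0, 1}) \<and>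
     (\<forall>j. 2 * j + 2 \<le> n \<longrightarrow>
        diagram (T ! (2 * j + 1)) \<subseteq> diagram (T ! (2 * j + 2)) \<and>
        card (diagram (T ! (2 * j + 2)) - diagram (T ! (2 * j + 1))) \<in> {0, 1})"

definition limiting_vacillating_tableau :: "nat \<Rightarrow> nat list \<Rightarrow> nat list list \<Rightarrow> bool" where
  "limiting_vacillating_tableau n \<mu> T \<longleftrightarrow>
     simplified_vacillating_tableau n \<mu> T \<and>
     (\<forall>j. 2 * j + 2 \<le> n \<longrightarrow>
        card (diagram (T ! (2 * j + 2)) - diagram (T ! (2 * j + 1))) = 1)"

text \<open>Both counts take the length of the tableaux as argument, that is, twice the usual subscript:
  \<open>g_num (2 * k)\<close> is $g_k$ and \<open>g_num (2 * k + 1)\<close> is $g_{k+1/2}$, and likewise for \<open>a_num\<close>.\<close>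

definition g_num :: "nat \<Rightarrow> nat list \<Rightarrow> nat" where
  "g_num n \<mu> = card {T. simplified_vacillating_tableau n \<mu> T}"

definition a_num :: "nat \<Rightarrow> nat list \<Rightarrow> nat" where
  "a_num n \<mu> = card {T. limiting_vacillating_tableau n \<mu> T}"

definition B_num :: "nat \<Rightarrow> nat \<Rightarrow> nat" where
  "B_num k j = card {(P, A). partition_on {1..k} P \<and> A \<subseteq> P \<and> card A = j}"

definition B_tilde :: "nat \<Rightarrow> nat \<Rightarrow> nat" where
  "B_tilde k j = card {(P, A). partition_on {1..k} P \<and> A \<subseteq> P \<and> card A = j \<and> (\<forall>X\<in>A. k \<notin> X)}"


text \<open>The sets of tableaux are finite and all but finitely many \<open>g_num n \<mu>\<close> vanish, so neither the
  cardinalities nor infinite sums of products of \<open>g_num\<close> and \<open>a_num\<close> over \<open>\<mu>\<close> take default values.\<close>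

lemma finite_diagram: "finite (diagram \<mu>)"
proof (rule finite_subset)
  show "diagram \<mu> \<subseteq> Sigma {..<length \<mu>} (\<lambda>i. {..<\<mu> ! i})"
    by (auto simp: diagram_def)
qed auto

lemma finite_card_diagram_le: "finite {\<mu>. int_partition \<mu> \<and> card (diagram \<mu>) \<le> n}"
proof (rule finite_subset)
  show "{\<mu>. int_partition \<mu> \<and> card (diagram \<mu>) \<le> n}
          \<subseteq> {\<mu>. set \<mu> \<subseteq> {..n} \<and> length \<mu> \<le> n}"
  proof safe
    fix \<mu> p assume *: "int_partition \<mu>" "card (diagram \<mu>) \<le> n" "p \<in> set \<mu>"
    then obtain i where i: "i < length \<mu>" "p = \<mu> ! i" by (auto simp: in_set_conv_nth)
    have "card (Pair i ` {..<p}) \<le> card (diagram \<mu>)"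
      using i by (intro card_mono finite_diagram) (auto simp: diagram_def)
    then show "p \<le> n" using *(2) by (simp add: card_image inj_on_def)
  next
    fix \<mu> assume *: "int_partition \<mu>" "card (diagram \<mu>) \<le> n"
    have "card ((\<lambda>i. (i, 0::nat)) ` {..<length \<mu>}) \<le> card (diagram \<mu>)"
      using *(1)
      by (intro card_mono[OF finite_diagram]) (fastforce simp: diagram_def int_partition_def)
    then show "length \<mu> \<le> n" using *(2) by (simp add: card_image inj_on_def)
  qed
  show "finite {\<mu>. set \<mu> \<subseteq> {..n} \<and> length \<mu> \<le> n}"
    by (rule finite_lists_length_le) simp
qed

lemma card_diagram_le:
  assumes T: "simplified_vacillating_tableau n \<mu> T" and "i \<le> n"
  shows "card (diagram (T ! i)) \<le> i"
  using assms(2)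
proof (induction i)
  case 0
  then show ?case using T by (simp add: simplified_vacillating_tableau_def diagram_def)
next
  case (Suc i)
  show ?case
  proof (cases "even i")
    case True
    then obtain j where j: "i = 2 * j" by blast
    then have "diagram (T ! Suc i) \<subseteq> diagram (T ! i)"
      using T Suc.prems by (simp add: simplified_vacillating_tableau_def)
    then have "card (diagram (T ! Suc i)) \<le> card (diagram (T ! i))"
      by (rule card_mono[OF finite_diagram])
    then show ?thesis using Suc by simp
  next
    case False
    then obtain j where j: "i = 2 * j + 1" by (auto elim: oddE)
    then have "diagram (T ! i) \<subseteq> diagram (T ! Suc i)"
        and c: "card (diagram (T ! Suc i) - diagram (T ! i)) \<in> {0, 1}"
      using T Suc.prems by (simp_all add: simplified_vacillating_tableau_def)
    then show ?thesis
      using card_Diff_subset[OF finite_diagram, of "T ! i" "diagram (T ! Suc i)"] Suc by auto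
  qed
qed

lemma finite_simplified_vacillating_tableaux: "finite {T. \<exists>\<mu>. simplified_vacillating_tableau n \<mu> T}"
proof (rule finite_subset)
  show "{T. \<exists>\<mu>. simplified_vacillating_tableau n \<mu> T}
          \<subseteq> {T. set T \<subseteq> {\<mu>. int_partition \<mu> \<and> card (diagram \<mu>) \<le> n} \<and> length T = n + 1}"
  proof safe
    fix T \<mu> \<nu> assume T: "simplified_vacillating_tableau n \<mu> T" and "\<nu> \<in> set T"
    moreover from T have len: "length T = n + 1" by (simp add: simplified_vacillating_tableau_def)
    ultimately obtain i where "i \<le> n" "\<nu> = T ! i"
      by (auto simp: in_set_conv_nth less_Suc_eq_le)
    then show "card (diagram \<nu>) \<le> n" using card_diagram_le[OF T] le_trans by blast
  qed (auto simp: simplified_vacillating_tableau_def)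
  show "finite {T. set T \<subseteq> {\<mu>. int_partition \<mu> \<and> card (diagram \<mu>) \<le> n} \<and> length T = n + 1}"
    by (intro finite_lists_length_eq finite_card_diagram_le)
qed

lemma finite_support_g: "finite {\<mu>. g_num n \<mu> \<noteq> 0}"
proof (rule finite_subset)
  show "{\<mu>. g_num n \<mu> \<noteq> 0} \<subseteq> (\<lambda>T. T ! n) ` {T. \<exists>\<mu>. simplified_vacillating_tableau n \<mu> T}"
  proof
    fix \<mu> assume "\<mu> \<in> {\<mu>. g_num n \<mu> \<noteq> 0}"
    then obtain T where "simplified_vacillating_tableau n \<mu> T"
      unfolding g_num_def by (metis (mono_tags) card.empty empty_Collect_eq mem_Collect_eq)
    then show "\<mu> \<in> (\<lambda>T. T ! n) ` {T. \<exists>\<mu>. simplified_vacillating_tableau n \<mu> T}"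
      by (auto simp: simplified_vacillating_tableau_def)
  qed
qed (intro finite_imageI finite_simplified_vacillating_tableaux)

lemma a_le_g: "a_num n \<mu> \<le> g_num n \<mu>"
  unfolding a_num_def g_num_def
  by (intro card_mono finite_subset[OF _ finite_simplified_vacillating_tableaux[of n]])
     (auto simp: limiting_vacillating_tableau_def)

lemma summable_g_a: "(\<lambda>\<mu>. g_num m \<mu> * a_num n \<mu>) summable_on M"
proof -
  have "(\<lambda>\<mu>. g_num m \<mu> * a_num n \<mu>) summable_on {\<mu>\<in>M. g_num m \<mu> \<noteq> 0}"
    by (intro summable_on_finite finite_subset[OF _ finite_support_g[of m]]) auto
  then show ?thesis
    by (rule iffD1[OF summable_on_cong_neutral, rotated -1]) auto
qed

lemma summable_a_a: "(\<lambda>\<mu>. a_num m \<mu> * a_num n \<mu>) summable_on M"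
proof -
  have "(\<lambda>\<mu>. a_num m \<mu> * a_num n \<mu>) summable_on {\<mu>\<in>M. g_num m \<mu> \<noteq> 0}"
    by (intro summable_on_finite finite_subset[OF _ finite_support_g[of m]]) auto
  then show ?thesis
    by (rule iffD1[OF summable_on_cong_neutral, rotated -1]) (use a_le_g[of m] in \<open>auto, metis le_zero_eq\<close>)
qed

end

theory Submission
  imports Defs
begin

text \<open>
  Let \<open>f \<mu>\<close> be the number of standard Young tableaux of shape \<open>\<mu>\<close>, that is, of saturated chains from
  the empty diagram to \<open>\<mu>\<close> in Young's lattice. Write \<open>U\<close> and \<open>D\<close> for the operators that add and remove
  a cell in all possible ways. A limiting tableau is a word in \<open>I + D\<close> and \<open>U\<close>, a simplified one a word
  in \<open>I + D\<close> and \<open>I + U\<close>, both applied to the empty diagram. Everything rests on the relation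
  \<open>D U - U D = I\<close> of Young's lattice (\<open>ups_finite_card\<close> on the diagonal and \<open>common_ups\<close> off it). It
  gives \<open>D U^(j+1) = (j+1) U^j\<close> on the empty diagram, so that the two families never leave the span of
  the vectors \<open>U^j\<close>, whose coordinate at a diagram \<open>\<mu>\<close> with \<open>j\<close> cells is \<open>f \<mu>\<close>. Hence
  \<open>g_num n \<mu>\<close> and \<open>a_num n \<mu>\<close> are \<open>f \<mu>\<close> times coefficients that depend only on \<open>n\<close> and on the size
  \<open>j\<close> of \<open>\<mu>\<close>, and a step changes these coefficients as follows (\<open>card_vac_chains\<close>): going down replaces
  \<open>c j\<close> by \<open>c j + (j+1) c (j+1)\<close>, and going up replaces it by \<open>c (j-1)\<close>, plus \<open>c j\<close> if resting is
  allowed. The Stirling numbers and the numbers \<open>B_num\<close> and \<open>B_tilde\<close> satisfy exactly these recurrences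
  (\<open>level_weight_g_num\<close>, \<open>level_weight_a_num\<close>). The same relation gives
  \<open>\<Sum> (f \<mu>)^2 = j!\<close> over the \<open>\<mu>\<close> of size \<open>j\<close>, so that each sum over partitions of a product of two of
  the counts collapses to \<open>\<Sum> j! c j d j\<close> (\<open>infsum_level_weight\<close>).

  The set partitions are counted by restricting them to an initial interval \<open>A\<close>. If all blocks
  meet \<open>A\<close>, such a set partition is the same thing as a set partition \<open>P\<close> of \<open>A\<close> together with a
  function from the remaining points to the blocks of \<open>P\<close> (\<open>bij_extend_blocks\<close>). So with \<open>p = card P\<close>
  and \<open>n\<close> remaining points, the counts are sums over \<open>P\<close> of \<open>p^n\<close>, of \<open>(p-1)^n\<close> if one block must
  not grow, of \<open>(p+1)^n\<close> if a fresh singleton block is attached first, and of a number of surjections if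
  all other blocks must grow. Expanding the powers in falling factorials with Stirling numbers as
  coefficients turns these sums into \<open>\<Sum> j! c j d j\<close> again.
\<close>

section \<open>Young's lattice\<close>

definition young :: "(nat \<times> nat) set \<Rightarrow> bool" where
  "young S \<longleftrightarrow> finite S \<and> (\<forall>i j i' j'. (i, j) \<in> S \<longrightarrow> i' \<le> i \<longrightarrow> j' \<le> j \<longrightarrow> (i', j') \<in> S)"

definition ups :: "(nat \<times> nat) set \<Rightarrow> (nat \<times> nat) set set" where
  "ups S = {T. young T \<and> S \<subseteq> T \<and> card (T - S) = 1}"

definition downs :: "(nat \<times> nat) set \<Rightarrow> (nat \<times> nat) set set" where
  "downs S = {T. young T \<and> T \<subseteq> S \<and> card (S - T) = 1}"

lemma youngD: "young S \<Longrightarrow> (i, j) \<in> S \<Longrightarrow> i' \<le> i \<Longrightarrow> j' \<le> j \<Longrightarrow> (i', j') \<in> S"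
  unfolding young_def by blast

lemma young_finite: "young S \<Longrightarrow> finite S"
  unfolding young_def by blast

lemma young_Un: "young S \<Longrightarrow> young T \<Longrightarrow> young (S \<union> T)"
  and young_Int: "young S \<Longrightarrow> young T \<Longrightarrow> young (S \<inter> T)"
  unfolding young_def by (blast, blast)

lemma subset_card_Diff_1_iff: "S \<subseteq> T \<and> card (T - S) = 1 \<longleftrightarrow> (\<exists>x. x \<notin> S \<and> T = insert x S)"
proof
  assume "S \<subseteq> T \<and> card (T - S) = 1"
  then obtain x where "T - S = {x}" "S \<subseteq> T" by (metis card_1_singletonE)
  then have "x \<notin> S \<and> T = insert x S" by auto
  then show "\<exists>x. x \<notin> S \<and> T = insert x S" ..
next
  assume "\<exists>x. x \<notin> S \<and> T = insert x S"
  then obtain x where x: "x \<notin> S" "T = insert x S" by metis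
  then have "T - S = {x}" by auto
  then show "S \<subseteq> T \<and> card (T - S) = 1" using x by auto
qed

lemma in_ups_iff: "T \<in> ups S \<longleftrightarrow> young T \<and> (\<exists>x. x \<notin> S \<and> T = insert x S)"
  and in_downs_iff: "T \<in> downs S \<longleftrightarrow> young T \<and> (\<exists>x. x \<notin> T \<and> S = insert x T)"
  by (simp_all only: ups_def downs_def mem_Collect_eq subset_card_Diff_1_iff)

lemma upsE:
  assumes "T \<in> ups S" obtains x where "x \<notin> S" "T = insert x S"
proof -
  have "\<exists>x. x \<notin> S \<and> T = insert x S" using assms unfolding in_ups_iff by (rule conjunct2)
  then show thesis using that by metis
qed

lemma downsE:
  assumes "T \<in> downs S" obtains x where "x \<notin> T" "S = insert x T"
proof -
  have "\<exists>x. x \<notin> T \<and> S = insert x T" using assms unfolding in_downs_iff by (rule conjunct2)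
  then show thesis using that by metis
qed

lemma ups_downs_iff: "young S \<Longrightarrow> young T \<Longrightarrow> T \<in> ups S \<longleftrightarrow> S \<in> downs T"
  by (simp add: in_ups_iff in_downs_iff)

lemma finite_downs: "young S \<Longrightarrow> finite (downs S)"
  by (rule finite_subset[of _ "Pow S"]) (auto simp: downs_def young_finite)

lemma card_ups: "young S \<Longrightarrow> T \<in> ups S \<Longrightarrow> card T = Suc (card S)"
  by (auto simp: in_ups_iff young_finite)

lemma card_downs: "young S \<Longrightarrow> T \<in> downs S \<Longrightarrow> card S = Suc (card T)"
  by (auto simp: in_downs_iff young_finite)

text \<open>
  A Young diagram is determined by its row lengths, which weakly decrease and vanish from some row on.
  In these coordinates the cells that can be added or removed are easy to list.
\<close>
lemma young_rows:
  assumes "young S"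
  obtains r :: "nat \<Rightarrow> nat" and N where "antimono r" "S = {(i, j). j < r i}" "\<And>i. r i = 0 \<longleftrightarrow> N \<le> i"
proof
  define r where "r = (\<lambda>i. LEAST j. (i, j) \<notin> S)"
  have ex: "\<exists>j. (i, j) \<notin> S" for i
  proof (rule ccontr)
    assume "\<not> ?thesis"
    then have "range (Pair i) \<subseteq> S" by auto
    then have "finite (range (Pair i :: nat \<Rightarrow> _))" using young_finite[OF assms] finite_subset by blast
    then show False by (simp add: finite_image_iff inj_on_def)
  qed
  have iff: "(i, j) \<in> S \<longleftrightarrow> j < r i" for i j
  proof
    assume "(i, j) \<in> S"
    then have "r i \<le> j \<Longrightarrow> False"
      using LeastI_ex[OF ex[of i]] youngD[OF assms] unfolding r_def by blast
    then show "j < r i" by force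
  next
    assume "j < r i"
    then show "(i, j) \<in> S" using not_less_Least unfolding r_def by blast
  qed
  show S: "S = {(i, j). j < r i}" using iff by auto
  show anti: "antimono r"
  proof (rule antimonoI, rule ccontr)
    fix x y :: nat assume "x \<le> y" "\<not> r y \<le> r x"
    then have "(y, r x) \<in> S" using iff by simp
    then have "(x, r x) \<in> S" using \<open>x \<le> y\<close> youngD[OF assms] by blast
    then show False using iff by simp
  qed
  have ex0: "\<exists>i. r i = 0"
  proof (rule ccontr)
    assume "\<not> ?thesis"
    then have "range (\<lambda>i. (i, 0::nat)) \<subseteq> S" using iff by auto
    then have "finite (range (\<lambda>i::nat. (i, 0::nat)))" using young_finite[OF assms] finite_subset by blast
    then show False by (simp add: finite_image_iff inj_on_def)
  qed
  show "r i = 0 \<longleftrightarrow> (LEAST i. r i = 0) \<le> i" for i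
    using Least_le[of "\<lambda>i. r i = 0" i] LeastI_ex[OF ex0] antimonoD[OF anti, of "LEAST i. r i = 0" i]
    by auto
qed

text \<open>
  A new cell must be placed at the end of its row, and then only the cell above it can be missing.
\<close>
lemma bij_ups_rows:
  assumes S: "S = {(i, j). j < r i}" and fin: "finite S" and anti: "antimono (r :: nat \<Rightarrow> nat)"
  shows "bij_betw (\<lambda>i. insert (i, r i) S) {i. i = 0 \<or> r i < r (i - 1)} (ups S)"
proof (rule bij_betw_imageI)
  show "inj_on (\<lambda>i. insert (i, r i) S) {i. i = 0 \<or> r i < r (i - 1)}"
    by (rule inj_onI) (auto simp: S set_eq_iff split: if_splits)
  have "T \<in> ups S" if T: "T = insert (i, r i) S" and i: "i = 0 \<or> r i < r (i - 1)" for i T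
  proof -
    have "(a', b') \<in> T" if ab: "(a, b) \<in> T" "a' \<le> a" "b' \<le> b" for a b a' b'
    proof (cases "(a, b) = (i, r i) \<and> a' < i")
      case True
      then have "r i < r (i - 1)" "r (i - 1) \<le> r a'" using i antimonoD[OF anti, of a' "i - 1"] by auto
      then show ?thesis using True ab by (auto simp: T S)
    next
      case False
      then show ?thesis using ab antimonoD[OF anti, of a' a] by (auto simp: T S)
    qed
    moreover have "finite T" using fin T by simp
    ultimately have "young T" unfolding young_def by blast
    then show ?thesis by (auto simp: in_ups_iff T S)
  qed
  moreover have "T \<in> (\<lambda>i. insert (i, r i) S) ` {i. i = 0 \<or> r i < r (i - 1)}" if up: "T \<in> ups S" for T
  proof -
    obtain i j where ij: "(i, j) \<notin> S" "T = insert (i, j) S" and y: "young T"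
      using up by (auto simp: in_ups_iff)
    have "r i \<le> j" using ij by (simp add: S)
    moreover have "\<not> r i < j" using youngD[OF y, of i j i "r i"] ij by (auto simp: S)
    ultimately have j: "j = r i" by simp
    have "r i < r (i - 1)" if "i \<noteq> 0" using youngD[OF y, of i j "i - 1" j] ij j that by (auto simp: S)
    then show ?thesis using j ij by auto
  qed
  ultimately show "(\<lambda>i. insert (i, r i) S) ` {i. i = 0 \<or> r i < r (i - 1)} = ups S" by blast
qed

text \<open>
  A removed cell must be the last one of its row, and then only the cell below it can be in the way.
\<close>
lemma bij_downs_rows:
  assumes S: "S = {(i, j). j < r i}" and fin: "finite S" and anti: "antimono (r :: nat \<Rightarrow> nat)"
  shows "bij_betw (\<lambda>i. S - {(i, r i - 1)}) {i. r (Suc i) < r i} (downs S)"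
proof (rule bij_betw_imageI)
  show "inj_on (\<lambda>i. S - {(i, r i - 1)}) {i. r (Suc i) < r i}"
  proof (rule inj_onI)
    fix a b assume *: "a \<in> {i. r (Suc i) < r i}" "b \<in> {i. r (Suc i) < r i}"
       "S - {(a, r a - 1)} = S - {(b, r b - 1)}"
    then have "(a, r a - 1) \<in> S" by (auto simp: S)
    then show "a = b" using *(3) by blast
  qed
  have "T \<in> downs S" if T: "T = S - {(i, r i - 1)}" and i: "r (Suc i) < r i" for i T
  proof -
    have "(a', b') \<in> T" if ab: "(a, b) \<in> T" "a' \<le> a" "b' \<le> b" for a b a' b'
    proof -
      have in_S: "(a', b') \<in> S" using ab antimonoD[OF anti, of a' a] by (auto simp: T S)
      have "(a', b') \<noteq> (i, r i - 1)"
      proof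
        assume e: "(a', b') = (i, r i - 1)"
        then have "a \<noteq> i" using ab i by (auto simp: T S)
        then have "Suc i \<le> a" using ab e by auto
        then have "r a \<le> r (Suc i)" using antimonoD[OF anti] by blast
        then show False using ab i e by (auto simp: T S)
      qed
      then show ?thesis using in_S T by blast
    qed
    moreover have "finite T" using fin T by simp
    ultimately have "young T" unfolding young_def by blast
    moreover have "(i, r i - 1) \<in> S" using i by (auto simp: S)
    ultimately show ?thesis by (auto simp: in_downs_iff T)
  qed
  moreover have "T \<in> (\<lambda>i. S - {(i, r i - 1)}) ` {i. r (Suc i) < r i}" if down: "T \<in> downs S" for T
  proof -
    obtain i j where ij: "(i, j) \<notin> T" "S = insert (i, j) T" and y: "young T"
      using down by (auto simp: in_downs_iff)
    have T: "T = S - {(i, j)}" using ij by auto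
    have "j < r i" using ij(2) S by auto
    moreover have "\<not> j < r i - 1" using youngD[OF y, of i "r i - 1" i j] ij(1) S T by auto
    ultimately have j: "j = r i - 1" "0 < r i" by auto
    have "r (Suc i) < r i"
      using youngD[OF y, of "Suc i" j i j] ij(1) S T j antimonoD[OF anti, of i "Suc i"] by force
    then show ?thesis using j T by auto
  qed
  ultimately show "(\<lambda>i. S - {(i, r i - 1)}) ` {i. r (Suc i) < r i} = downs S" by blast
qed

text \<open>
  The diagonal part of \<open>D U - U D = I\<close>: a row can lose a cell exactly when the row below it can gain
  one, and the top row can always gain one.
\<close>
lemma ups_finite_card:
  assumes "young S"
  shows "finite (ups S)" "card (ups S) = Suc (card (downs S))"
proof -
  obtain r N where r: "antimono r" "S = {(i, j). j < r i}" "\<And>i. r i = 0 \<longleftrightarrow> N \<le> i"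
    using young_rows[OF assms] by metis
  let ?D = "{i. r (Suc i) < r i}"
  have U: "{i. i = 0 \<or> r i < r (i - 1)} = insert 0 (Suc ` ?D)"
  proof (rule set_eqI)
    show "i \<in> {i. i = 0 \<or> r i < r (i - 1)} \<longleftrightarrow> i \<in> insert 0 (Suc ` ?D)" for i
      by (cases i) auto
  qed
  have "?D \<subseteq> {..<N}" using r(3) by (auto simp: not_le[symmetric]) (metis le0)
  then have fin: "finite ?D" using finite_subset by blast
  note bu = bij_ups_rows[OF r(2) young_finite[OF assms] r(1), unfolded U]
    and bd = bij_downs_rows[OF r(2) young_finite[OF assms] r(1)]
  show "finite (ups S)" using bij_betw_finite[OF bu] fin by simp
  show "card (ups S) = Suc (card (downs S))"
    using bij_betw_same_card[OF bu] bij_betw_same_card[OF bd] fin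
    by (simp add: card_image)
qed

text \<open>
  The off-diagonal part of \<open>D U - U D = I\<close>: the only candidates for a common upper and a common lower
  cover are the union and the intersection, and one of them is a cover if and only if the other is.
\<close>
lemma common_ups:
  assumes "young S" "young T" "S \<noteq> T"
  shows "card (ups S \<inter> ups T) = card (downs S \<inter> downs T)"
proof -
  have up: "U = S \<union> T" if "U \<in> ups S \<inter> ups T" for U
  proof -
    have "U \<in> ups S" "U \<in> ups T" using that by simp_all
    obtain x where x: "x \<notin> S" "U = insert x S" using upsE[OF \<open>U \<in> ups S\<close>] by metis
    obtain y where y: "y \<notin> T" "U = insert y T" using upsE[OF \<open>U \<in> ups T\<close>] by metis
    have "x \<noteq> y" using x y assms(3) insert_ident by metis
    then have "x \<in> T" using x(2) y(2) by (metis insertE insertI1)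
    moreover have "T \<subseteq> insert x S" using x(2) y(2) by (metis subset_insertI)
    ultimately show ?thesis unfolding x(2) by blast
  qed
  have down: "D = S \<inter> T" if "D \<in> downs S \<inter> downs T" for D
  proof -
    have "D \<in> downs S" "D \<in> downs T" using that by simp_all
    obtain x where x: "x \<notin> D" "S = insert x D" using downsE[OF \<open>D \<in> downs S\<close>] by metis
    obtain y where y: "y \<notin> D" "T = insert y D" using downsE[OF \<open>D \<in> downs T\<close>] by metis
    have "x \<noteq> y" using x y assms(3) by metis
    then show ?thesis unfolding x(2) y(2) by blast
  qed
  have "S \<union> T \<in> ups S \<inter> ups T \<longleftrightarrow> S \<inter> T \<in> downs S \<inter> downs T"
  proof -
    have "(S \<union> T) - S = T - S \<inter> T" "(S \<union> T) - T = S - S \<inter> T" by auto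
    then show ?thesis using young_Un[OF assms(1,2)] young_Int[OF assms(1,2)]
      by (auto simp: ups_def downs_def)
  qed
  then have "ups S \<inter> ups T = {S \<union> T} \<and> downs S \<inter> downs T = {S \<inter> T} \<or>
             ups S \<inter> ups T = {} \<and> downs S \<inter> downs T = {}"
    using up down by blast
  then show ?thesis by auto
qed

section \<open>Standard Young tableaux\<close>

text \<open>
  For a diagram \<open>S\<close> with \<open>n\<close> cells this is the number of standard Young tableaux of shape \<open>S\<close>: the
  cell with the largest entry is removed first. The explicit \<open>n\<close> makes the recursion structural; if
  it is not the number of cells, the value is \<open>0\<close> on Young diagrams.
\<close>
fun syt_num :: "nat \<Rightarrow> (nat \<times> nat) set \<Rightarrow> nat" where
  "syt_num 0 S = (if S = {} then 1 else 0)"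
| "syt_num (Suc n) S = (\<Sum>T\<in>downs S. syt_num n T)"

text \<open>
  The relation \<open>D U = I + U D\<close>, tested against a function \<open>h\<close>. Both sides are rewritten as a sum over
  all \<open>T\<close> near \<open>S\<close> in which \<open>h T\<close> is weighted by a number of common covers.
\<close>
lemma sum_ups_swap:
  fixes h :: "(nat \<times> nat) set \<Rightarrow> nat"
  assumes "young S"
  shows "(\<Sum>U\<in>ups S. \<Sum>T\<in>downs U. h T) = h S + (\<Sum>D\<in>downs S. \<Sum>T\<in>ups D. h T)"
proof -
  \<comment> \<open>a finite index set that contains every diagram occurring on either side\<close>
  let ?X = "(\<Union>U\<in>ups S. downs U) \<union> (\<Union>D\<in>downs S. ups D) \<union> {S}"
  have yU: "\<And>U. U \<in> ups S \<Longrightarrow> young U" and yD: "\<And>D. D \<in> downs S \<Longrightarrow> young D"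
    by (auto simp: ups_def downs_def)
  note finU = ups_finite_card(1)[OF assms] and finD = finite_downs[OF assms]
  have fin: "finite ?X"
    using finU finD ups_finite_card(1)[OF yD] finite_downs[OF yU] by auto
  have y: "young T" if "T \<in> ?X" for T
    using that assms by (auto simp: ups_def downs_def)
  have restrict: "sum h Z = (\<Sum>T\<in>?X. if T \<in> Z then h T else 0)" if "Z \<subseteq> ?X" for Z
    using sum.inter_restrict[OF fin, of h Z] that by (simp only: Int_absorb1)
  have "(\<Sum>U\<in>ups S. \<Sum>T\<in>downs U. h T) = (\<Sum>U\<in>ups S. \<Sum>T\<in>?X. if T \<in> downs U then h T else 0)"
    by (intro sum.cong refl restrict) blast
  also have "\<dots> = (\<Sum>T\<in>?X. \<Sum>U\<in>ups S. if T \<in> downs U then h T else 0)"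
    by (rule sum.swap)
  also have "\<dots> = (\<Sum>T\<in>?X. card (ups S \<inter> ups T) * h T)"
  proof (rule sum.cong[OF refl])
    fix T assume T: "T \<in> ?X"
    have "ups S \<inter> ups T = {U \<in> ups S. T \<in> downs U}"
      using ups_downs_iff[OF y[OF T]] yU by auto
    then show "(\<Sum>U\<in>ups S. if T \<in> downs U then h T else 0) = card (ups S \<inter> ups T) * h T"
      using finU by (simp add: sum.inter_filter[symmetric])
  qed
  also have "\<dots> = (\<Sum>T\<in>?X. (if T = S then h S else 0) + card (downs S \<inter> downs T) * h T)"
    using common_ups[OF assms] ups_finite_card(2)[OF assms] y by (intro sum.cong refl) auto
  also have "\<dots> = h S + (\<Sum>T\<in>?X. card (downs S \<inter> downs T) * h T)"
    using fin by (subst sum.distrib, subst sum.delta) auto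
  also have "(\<Sum>T\<in>?X. card (downs S \<inter> downs T) * h T)
      = (\<Sum>T\<in>?X. \<Sum>D\<in>downs S. if T \<in> ups D then h T else 0)"
  proof (rule sum.cong[OF refl])
    fix T assume T: "T \<in> ?X"
    have "downs S \<inter> downs T = {D \<in> downs S. T \<in> ups D}"
      using ups_downs_iff[OF _ y[OF T]] yD by auto
    then show "card (downs S \<inter> downs T) * h T = (\<Sum>D\<in>downs S. if T \<in> ups D then h T else 0)"
      using finD by (simp add: sum.inter_filter[symmetric])
  qed
  also have "\<dots> = (\<Sum>D\<in>downs S. \<Sum>T\<in>?X. if T \<in> ups D then h T else 0)"
    by (rule sum.swap)
  also have "\<dots> = (\<Sum>D\<in>downs S. \<Sum>T\<in>ups D. h T)"
    by (intro sum.cong refl restrict[symmetric]) blast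
  finally show ?thesis .
qed

text \<open>
  The identity \<open>D U^(n+1) = (n+1) U^n\<close> on the empty diagram, read at the coordinate \<open>S\<close>. By induction,
  each of the \<open>n+1\<close> letters \<open>U\<close> that \<open>D\<close> is moved past contributes one summand \<open>U^n\<close>.
\<close>
lemma sum_ups_syt_num:
  "young S \<Longrightarrow> card S = n \<Longrightarrow> (\<Sum>U\<in>ups S. syt_num (Suc n) U) = Suc n * syt_num n S"
proof (induction n arbitrary: S)
  case 0
  then have S: "S = {}" by (simp add: young_finite)
  have d: "downs S = {}" by (auto simp: in_downs_iff S)
  have "(\<Sum>U\<in>ups S. \<Sum>T\<in>downs U. syt_num 0 T) = syt_num 0 S"
    using sum_ups_swap[OF 0(1), of "syt_num 0"] d by simp
  then show ?case by simp
next
  case (Suc n)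
  have "(\<Sum>D\<in>downs S. \<Sum>T\<in>ups D. syt_num (Suc n) T) = (\<Sum>D\<in>downs S. Suc n * syt_num n D)"
    using Suc card_downs[OF Suc.prems(1)] by (intro sum.cong refl Suc.IH) (auto simp: downs_def)
  then have "(\<Sum>U\<in>ups S. \<Sum>T\<in>downs U. syt_num (Suc n) T) = Suc (Suc n) * syt_num (Suc n) S"
    using sum_ups_swap[OF Suc.prems(1), of "syt_num (Suc n)"]
    by (simp only: sum_distrib_left[symmetric] syt_num.simps(2)) simp
  then show ?case by simp
qed

lemma young_diagram: "int_partition \<mu> \<Longrightarrow> young (diagram \<mu>)"
proof -
  assume ip: "int_partition \<mu>"
  have "\<mu> ! i \<le> \<mu> ! i'" if "i' \<le> i" "i < length \<mu>" for i i'
    using ip that by (cases "i = i'") (auto simp: int_partition_def sorted_wrt_iff_nth_less)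
  then show ?thesis
    unfolding young_def using finite_diagram by (fastforce simp: diagram_def)
qed

lemma diagram_inj: "inj_on diagram (Collect int_partition)"
proof (rule inj_onI)
  fix \<mu> \<nu> assume ip: "\<mu> \<in> Collect int_partition" "\<nu> \<in> Collect int_partition" and eq: "diagram \<mu> = diagram \<nu>"
  have len: "i < length \<mu> \<longleftrightarrow> (i, 0) \<in> diagram \<mu>" if "int_partition \<mu>" for i \<mu>
    using that by (auto simp: int_partition_def diagram_def)
  have "i < length \<mu> \<longleftrightarrow> i < length \<nu>" for i using len ip eq by auto
  then have l: "length \<mu> = length \<nu>" by (metis linorder_neqE_nat less_irrefl)
  show "\<mu> = \<nu>"
  proof (rule nth_equalityI[OF l])
    fix i assume i: "i < length \<mu>"
    have "j < \<mu> ! i \<longleftrightarrow> j < \<nu> ! i" for j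
      using eq i l by (auto simp: diagram_def set_eq_iff)
    then show "\<mu> ! i = \<nu> ! i" by (metis linorder_neqE_nat less_irrefl)
  qed
qed

text \<open>
  Together with injectivity of \<open>diagram\<close> this allows sums over partitions to be replaced by sums over
  Young diagrams.
\<close>
lemma diagram_surj: assumes "young S" shows "S \<in> diagram ` Collect int_partition"
proof -
  obtain r N where r: "antimono r" "S = {(i, j). j < r i}" "\<And>i. r i = 0 \<longleftrightarrow> N \<le> i"
    using young_rows[OF assms] by metis
  have "r i > 0" if "i < N" for i using r(3)[of i] that by simp
  then have "int_partition (map r [0..<N])"
    by (auto simp: int_partition_def sorted_wrt_iff_nth_less intro!: antimonoD[OF r(1)])
  moreover have "diagram (map r [0..<N]) = S"
  proof (rule set_eqI)
    fix x :: "nat \<times> nat"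
    show "x \<in> diagram (map r [0..<N]) \<longleftrightarrow> x \<in> S"
      using r(3)[of "fst x"] by (cases x; cases "fst x < N") (auto simp: diagram_def r(2))
  qed
  ultimately show ?thesis by blast
qed

lemma bij_diagram: "bij_betw diagram (Collect int_partition) (Collect young)"
  using diagram_inj diagram_surj young_diagram by (auto simp: bij_betw_def)

lemma finite_young: "finite {S. young S \<and> card S = n}"
proof (rule finite_subset)
  show "{S. young S \<and> card S = n} \<subseteq> diagram ` {\<mu>. int_partition \<mu> \<and> card (diagram \<mu>) \<le> n}"
    using diagram_surj by fastforce
qed (intro finite_imageI finite_card_diagram_le)

text \<open>
  Splitting one factor of the square over the lower covers and summing over the upper covers first
  turns the sum on level \<open>n+1\<close> into \<open>n+1\<close> times the sum on level \<open>n\<close>.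
\<close>
lemma sum_syt_num_square: "(\<Sum>S | young S \<and> card S = n. (syt_num n S)\<^sup>2) = fact n"
proof (induction n)
  case 0
  have "{S. young S \<and> card S = 0} = {{}}" by (auto simp: young_def)
  then show ?case by simp
next
  case (Suc n)
  let ?Y = "\<lambda>n. {S. young S \<and> card S = n}"
  have dY: "downs S = {T. T \<in> ?Y n \<and> T \<in> downs S}" if "S \<in> ?Y (Suc n)" for S
  proof -
    have "T \<in> ?Y n" if T: "T \<in> downs S" for T
      using card_downs[OF _ T] \<open>S \<in> ?Y (Suc n)\<close> T by (simp add: downs_def)
    then show ?thesis by blast
  qed
  have uY: "{S. S \<in> ?Y (Suc n) \<and> T \<in> downs S} = ups T" if "T \<in> ?Y n" for T
  proof -
    have T: "young T" "card T = n" using that by auto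
    have "S \<in> ?Y (Suc n) \<and> T \<in> downs S \<longleftrightarrow> S \<in> ups T" for S
      using ups_downs_iff[OF T(1), of S] card_ups[OF T(1), of S] T(2)
      by (auto simp only: mem_Collect_eq ups_def)
    then show ?thesis by blast
  qed
  have "(\<Sum>S\<in>?Y (Suc n). (syt_num (Suc n) S)\<^sup>2)
      = (\<Sum>S\<in>?Y (Suc n). \<Sum>T\<in>downs S. syt_num (Suc n) S * syt_num n T)"
    by (simp add: power2_eq_square sum_distrib_left)
  also have "\<dots> = (\<Sum>S\<in>?Y (Suc n). \<Sum>T | T \<in> ?Y n \<and> T \<in> downs S. syt_num (Suc n) S * syt_num n T)"
    using dY by (intro sum.cong refl) auto
  also have "\<dots> = (\<Sum>T\<in>?Y n. \<Sum>S | S \<in> ?Y (Suc n) \<and> T \<in> downs S. syt_num (Suc n) S * syt_num n T)"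
    by (rule sum.swap_restrict[OF finite_young finite_young])
  also have "\<dots> = (\<Sum>T\<in>?Y n. Suc n * (syt_num n T)\<^sup>2)"
  proof (rule sum.cong[OF refl])
    fix T assume T: "T \<in> ?Y n"
    have "(\<Sum>S | S \<in> ?Y (Suc n) \<and> T \<in> downs S. syt_num (Suc n) S * syt_num n T)
        = (\<Sum>S\<in>ups T. syt_num (Suc n) S) * syt_num n T"
      using uY[OF T] by (simp only: sum_distrib_right)
    also have "\<dots> = Suc n * (syt_num n T)\<^sup>2"
      using sum_ups_syt_num[of T n] T by (simp add: power2_eq_square algebra_simps del: syt_num.simps)
    finally show "(\<Sum>S | S \<in> ?Y (Suc n) \<and> T \<in> downs S. syt_num (Suc n) S * syt_num n T) = Suc n * (syt_num n T)\<^sup>2" .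
  qed
  also have "\<dots> = fact (Suc n)" using Suc.IH by (simp only: sum_distrib_left[symmetric]) simp
  finally show ?case .
qed

text \<open>
  In operator terms: \<open>G\<close> is the linear combination of the vectors \<open>U^j\<close> applied to the empty diagram
  with coefficients \<open>c j\<close>.
\<close>
definition level_weight :: "(nat list \<Rightarrow> nat) \<Rightarrow> (nat \<Rightarrow> nat) \<Rightarrow> bool" where
  "level_weight G c \<longleftrightarrow>
     (\<forall>\<mu>. int_partition \<mu> \<longrightarrow> G \<mu> = c (card (diagram \<mu>)) * syt_num (card (diagram \<mu>)) (diagram \<mu>))"

text \<open>
  The vectors \<open>U^j\<close> on the empty diagram are orthogonal, since they live on different levels, and the
  square of the length of \<open>U^j\<close> is \<open>j!\<close>.
\<close>
lemma infsum_level_weight: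
  assumes G: "level_weight G c" and H: "level_weight H d"
    and d: "\<And>j. j > N \<Longrightarrow> d j = 0"
  shows "(\<Sum>\<^sub>\<infinity>\<mu>\<in>Collect int_partition. G \<mu> * H \<mu>) = (\<Sum>j\<le>N. fact j * c j * d j)"
proof -
  define p where "p = (\<lambda>S. c (card S) * d (card S) * (syt_num (card S) S)\<^sup>2)"
  let ?Y = "\<lambda>j. {S. young S \<and> card S = j}"
  have "(\<Sum>\<^sub>\<infinity>\<mu>\<in>Collect int_partition. G \<mu> * H \<mu>) = (\<Sum>\<^sub>\<infinity>\<mu>\<in>Collect int_partition. p (diagram \<mu>))"
    using G H by (intro infsum_cong) (simp add: level_weight_def p_def power2_eq_square)
  also have "\<dots> = (\<Sum>\<^sub>\<infinity>S\<in>Collect young. p S)"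
    by (rule infsum_reindex_bij_betw[OF bij_diagram])
  also have "\<dots> = (\<Sum>\<^sub>\<infinity>S\<in>(\<Union>j\<le>N. ?Y j). p S)"
    by (rule infsum_cong_neutral) (auto simp: p_def d)
  also have "\<dots> = sum p (\<Union>j\<le>N. ?Y j)"
    using finite_young by (intro infsum_finite) auto
  also have "\<dots> = (\<Sum>j\<le>N. sum p (?Y j))"
    using finite_young by (intro sum.UNION_disjoint) auto
  also have "\<dots> = (\<Sum>j\<le>N. fact j * c j * d j)"
  proof (rule sum.cong[OF refl])
    fix j
    have "sum p (?Y j) = (\<Sum>S\<in>?Y j. c j * d j * (syt_num j S)\<^sup>2)"
      by (rule sum.cong) (auto simp: p_def)
    also have "\<dots> = c j * d j * fact j"
      unfolding sum_distrib_left[symmetric] sum_syt_num_square by simp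
    finally show "sum p (?Y j) = fact j * c j * d j" by (simp add: ac_simps)
  qed
  finally show ?thesis .
qed

section \<open>Vacillating tableaux as walks in Young's lattice\<close>

text \<open>
  Simplified and limiting tableaux differ only in the steps that they allow, so both are treated as
  chains for a step relation \<open>R\<close>, which may depend on the position in the chain.
\<close>
definition step_chains :: "(nat \<Rightarrow> nat list \<Rightarrow> nat list \<Rightarrow> bool) \<Rightarrow> nat \<Rightarrow> nat list \<Rightarrow> nat list list set" where
  "step_chains R n \<mu> = {T. length T = n + 1 \<and> (\<forall>\<nu>\<in>set T. int_partition \<nu>) \<and> T ! 0 = [] \<and> T ! n = \<mu> \<and>
     (\<forall>i<n. R i (T ! i) (T ! Suc i))}"

lemma int_partition_Nil: "int_partition []"
  by (simp add: int_partition_def)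

lemma step_chains_0: "step_chains R 0 \<mu> = (if \<mu> = [] then {[[]]} else {})"
  by (auto simp: step_chains_def length_Suc_conv int_partition_Nil)

lemma step_chains_Suc:
  assumes "int_partition \<mu>"
  shows "step_chains R (Suc n) \<mu>
    = (\<Union>\<nu>\<in>{\<nu>. int_partition \<nu> \<and> R n \<nu> \<mu>}. (\<lambda>T. T @ [\<mu>]) ` step_chains R n \<nu>)" (is "_ = ?U")
proof (intro equalityI subsetI)
  fix T assume T: "T \<in> step_chains R (Suc n) \<mu>"
  then have len: "length T = Suc (Suc n)" by (simp add: step_chains_def)
  then have "T \<noteq> []" by auto
  have bl: "butlast T ! i = T ! i" if "i \<le> n" for i using len that by (simp add: nth_butlast)
  have "last T = \<mu>" using T \<open>T \<noteq> []\<close> len by (simp add: step_chains_def last_conv_nth)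
  then have eq: "T = butlast T @ [\<mu>]" using \<open>T \<noteq> []\<close> append_butlast_last_id[of T] by simp
  have ip: "int_partition (T ! n)" using T len by (auto simp: step_chains_def)
  have R: "R n (T ! n) \<mu>" using T by (auto simp: step_chains_def)
  have "butlast T \<in> step_chains R n (T ! n)"
    using T len bl by (auto simp: step_chains_def dest: in_set_butlastD)
  then show "T \<in> ?U" using ip R by (subst eq) blast
next
  fix T assume "T \<in> ?U"
  then obtain \<nu> T' where *: "int_partition \<nu>" "R n \<nu> \<mu>" "T' \<in> step_chains R n \<nu>" "T = T' @ [\<mu>]"
    by blast
  then have len: "length T' = Suc n" by (simp add: step_chains_def)
  have nth: "T ! i = T' ! i" if "i \<le> n" for i using that len *(4) by (simp add: nth_append)
  have last: "T ! Suc n = \<mu>" using len *(4) by (simp add: nth_append)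
  have "R i (T ! i) (T ! Suc i)" if "i < Suc n" for i
    using that nth[of i] nth[of "Suc i"] last *(2,3) by (cases "i = n") (auto simp: step_chains_def)
  then show "T \<in> step_chains R (Suc n) \<mu>"
    using *(3,4) assms len nth[of 0] last by (auto simp: step_chains_def)
qed

lemma finite_step_chains:
  assumes "\<And>n \<mu>. int_partition \<mu> \<Longrightarrow> finite {\<nu>. int_partition \<nu> \<and> R n \<nu> \<mu>}"
  shows "int_partition \<mu> \<Longrightarrow> finite (step_chains R n \<mu>)"
proof (induction n arbitrary: \<mu>)
  case (Suc n)
  then show ?case using assms[OF Suc.prems] by (auto simp: step_chains_Suc)
qed (simp add: step_chains_0)

lemma card_step_chains_Suc:
  assumes fin: "\<And>n \<mu>. int_partition \<mu> \<Longrightarrow> finite {\<nu>. int_partition \<nu> \<and> R n \<nu> \<mu>}"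
    and ip: "int_partition \<mu>"
  shows "card (step_chains R (Suc n) \<mu>) = (\<Sum>\<nu> | int_partition \<nu> \<and> R n \<nu> \<mu>. card (step_chains R n \<nu>))"
proof -
  have disj: "(\<lambda>T. T @ [\<mu>]) ` step_chains R n \<nu> \<inter> (\<lambda>T. T @ [\<mu>]) ` step_chains R n \<nu>' = {}"
    if "\<nu> \<noteq> \<nu>'" for \<nu> \<nu>'
    using that by (auto simp: step_chains_def)
  have "card (step_chains R (Suc n) \<mu>)
      = (\<Sum>\<nu> | int_partition \<nu> \<and> R n \<nu> \<mu>. card ((\<lambda>T. T @ [\<mu>]) ` step_chains R n \<nu>))"
    unfolding step_chains_Suc[OF ip] using fin[OF ip] finite_step_chains[of R, OF fin] disj
    by (intro card_UN_disjoint) blast+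
  then show ?thesis by (simp add: card_image inj_on_def)
qed

text \<open>
  The set \<open>A\<close> contains the numbers of cells that an upward step may add: \<open>{0, 1}\<close> gives the simplified
  tableaux and \<open>{1}\<close> the limiting ones.
\<close>
definition vac_step :: "nat set \<Rightarrow> nat \<Rightarrow> nat list \<Rightarrow> nat list \<Rightarrow> bool" where
  "vac_step A i \<nu> \<mu> \<longleftrightarrow>
     (if even i then diagram \<mu> \<subseteq> diagram \<nu> \<and> card (diagram \<nu> - diagram \<mu>) \<in> {0, 1}
      else diagram \<nu> \<subseteq> diagram \<mu> \<and> card (diagram \<mu> - diagram \<nu>) \<in> A)"

text \<open>
  Tableaux are defined by separate conditions on the downward steps, from even positions, and on the
  upward steps, from odd positions; chains have one condition for all positions.
\<close>
lemma all_less_parity: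
  fixes n :: nat and P :: "nat \<Rightarrow> bool"
  shows
  "(\<forall>i<n. P i) \<longleftrightarrow> (\<forall>j. 2 * j + 1 \<le> n \<longrightarrow> P (2 * j)) \<and> (\<forall>j. 2 * j + 2 \<le> n \<longrightarrow> P (2 * j + 1))"
proof (intro iffI allI impI)
  fix i assume *: "(\<forall>j. 2 * j + 1 \<le> n \<longrightarrow> P (2 * j)) \<and> (\<forall>j. 2 * j + 2 \<le> n \<longrightarrow> P (2 * j + 1))" "i < n"
  show "P i"
  proof (cases "even i")
    case True
    then obtain j where "i = 2 * j" by blast
    then show ?thesis using * by simp
  next
    case False
    then obtain j where "i = 2 * j + 1" by (rule oddE)
    then show ?thesis using * by simp
  qed
qed auto

lemma simplified_eq_step_chains:
  "{T. simplified_vacillating_tableau n \<mu> T} = step_chains (vac_step {0, 1}) n \<mu>"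
  unfolding step_chains_def all_less_parity simplified_vacillating_tableau_def by (simp add: vac_step_def)

lemma limiting_eq_step_chains:
  "{T. limiting_vacillating_tableau n \<mu> T} = step_chains (vac_step {1}) n \<mu>"
  unfolding step_chains_def all_less_parity simplified_vacillating_tableau_def limiting_vacillating_tableau_def
  by (auto simp add: vac_step_def)

lemma bij_diagram_Collect:
  "bij_betw diagram {\<nu>. int_partition \<nu> \<and> P (diagram \<nu>)} {S. young S \<and> P S}"
  by (rule bij_betw_subset[OF bij_diagram]) (use diagram_surj young_diagram in auto)

lemma Collect_above:
  assumes "young S"
  shows "{T. young T \<and> S \<subseteq> T \<and> card (T - S) \<in> {0, 1}} = insert S (ups S)"
  using assms young_finite by (auto simp: ups_def)

lemma Collect_below:
  assumes "young S" "A \<subseteq> {0, 1}" "1 \<in> A"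
  shows "{T. young T \<and> T \<subseteq> S \<and> card (S - T) \<in> A} = (if 0 \<in> A then {S} else {}) \<union> downs S"
proof (rule set_eqI)
  fix T
  have "card (S - T) = 0 \<longleftrightarrow> S \<subseteq> T" using assms(1) young_finite by auto
  moreover have "card (S - T) \<in> A \<longleftrightarrow> (0 \<in> A \<and> card (S - T) = 0) \<or> card (S - T) = 1"
    using assms by auto
  ultimately show "T \<in> {T. young T \<and> T \<subseteq> S \<and> card (S - T) \<in> A} \<longleftrightarrow> T \<in> (if 0 \<in> A then {S} else {}) \<union> downs S"
    using assms(1) by (auto simp: downs_def)
qed

lemma vac_step_diagram:
  assumes ip: "int_partition \<mu>" and A: "A \<subseteq> {0, 1}" "1 \<in> A"
  shows "bij_betw diagram {\<nu>. int_partition \<nu> \<and> vac_step A i \<nu> \<mu>}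
    (if even i then insert (diagram \<mu>) (ups (diagram \<mu>))
     else (if 0 \<in> A then {diagram \<mu>} else {}) \<union> downs (diagram \<mu>))"
proof -
  note y = young_diagram[OF ip]
  show ?thesis
    using bij_diagram_Collect[of "\<lambda>S. diagram \<mu> \<subseteq> S \<and> card (S - diagram \<mu>) \<in> {0, 1}"]
      bij_diagram_Collect[of "\<lambda>S. S \<subseteq> diagram \<mu> \<and> card (diagram \<mu> - S) \<in> A"]
    unfolding Collect_above[OF y] Collect_below[OF y A] vac_step_def by simp
qed

text \<open>
  A downward step of the tableau sums over a diagram and its upper covers, where \<open>sum_ups_syt_num\<close>
  produces the factor \<open>j+1\<close>. An upward step sums over the lower covers, where the defining recursion of
  \<open>syt_num\<close> applies.
\<close>
lemma card_vac_chains: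
  fixes c :: "nat \<Rightarrow> nat \<Rightarrow> nat"
  assumes A: "A \<subseteq> {0, 1}" "1 \<in> A"
    and c0: "\<And>j. c 0 j = (if j = 0 then 1 else 0)"
    and c_odd: "\<And>k j. c (2 * k + 1) j = c (2 * k) j + Suc j * c (2 * k) (Suc j)"
    and c_even: "\<And>k j. c (2 * k + 2) j
        = (if 0 \<in> A then c (2 * k + 1) j else 0) + (if j = 0 then 0 else c (2 * k + 1) (j - 1))"
  shows "int_partition \<mu> \<Longrightarrow> card (step_chains (vac_step A) n \<mu>)
      = c n (card (diagram \<mu>)) * syt_num (card (diagram \<mu>)) (diagram \<mu>)"
proof (induction n arbitrary: \<mu>)
  case 0
  have "diagram \<mu> = diagram [] \<longleftrightarrow> \<mu> = []"
    using 0 int_partition_Nil inj_on_eq_iff[OF diagram_inj] by blast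
  then have "diagram \<mu> = {} \<longleftrightarrow> \<mu> = []" by (simp add: diagram_def)
  then show ?case using finite_diagram[of \<mu>] by (auto simp: step_chains_0 c0)
next
  case (Suc n)
  define S where "S = diagram \<mu>"
  define m where "m = card S"
  define w where "w = (\<lambda>T. c n (card T) * syt_num (card T) T)"
  have y: "young S" unfolding S_def by (rule young_diagram) fact
  have finS: "finite (ups S)" "finite (downs S)" using ups_finite_card(1) finite_downs y by auto
  have fin: "finite {\<nu>. int_partition \<nu> \<and> vac_step A n \<nu> \<mu>}" if "int_partition \<mu>" for n \<mu>
    using bij_betw_finite[OF vac_step_diagram[OF that A]] ups_finite_card(1) finite_downs young_diagram[OF that]
    by (auto split: if_splits)
  have "card (step_chains (vac_step A) (Suc n) \<mu>)
      = (\<Sum>\<nu> | int_partition \<nu> \<and> vac_step A n \<nu> \<mu>. w (diagram \<nu>))"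
    using card_step_chains_Suc[of "vac_step A", OF fin Suc.prems] Suc.IH by (simp add: w_def)
  also have "\<dots> = sum w (if even n then insert S (ups S) else (if 0 \<in> A then {S} else {}) \<union> downs S)"
    unfolding S_def by (rule sum.reindex_bij_betw[OF vac_step_diagram[OF Suc.prems A]])
  also have "\<dots> = c (Suc n) m * syt_num m S"
  proof (cases "even n")
    case True
    then obtain k where k: "n = 2 * k" by blast
    have "sum w (ups S) = (\<Sum>T\<in>ups S. c n (Suc m) * syt_num (Suc m) T)"
      using card_ups[OF y] by (intro sum.cong) (simp_all add: w_def m_def)
    also have "\<dots> = c n (Suc m) * (Suc m * syt_num m S)"
      unfolding sum_distrib_left[symmetric] using sum_ups_syt_num[OF y, of m] m_def by simp
    finally have up: "sum w (ups S) = c n (Suc m) * (Suc m * syt_num m S)" .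
    have "S \<notin> ups S" by (auto simp: ups_def)
    then have "sum w (insert S (ups S)) = c n m * syt_num m S + c n (Suc m) * (Suc m * syt_num m S)"
      using up finS by (simp add: w_def m_def)
    then show ?thesis using True c_odd[of k m] k by (simp add: algebra_simps)
  next
    case False
    then obtain k where k: "n = 2 * k + 1" by (rule oddE)
    have down: "sum w (downs S) = (if m = 0 then 0 else c n (m - 1)) * syt_num m S"
    proof (cases m)
      case 0
      then have "S = {}" using m_def y young_finite by simp
      then show ?thesis using 0 by (simp add: in_downs_iff downs_def)
    next
      case (Suc m')
      have "sum w (downs S) = (\<Sum>T\<in>downs S. c n m' * syt_num m' T)"
        using card_downs[OF y] Suc by (intro sum.cong) (simp_all add: w_def m_def)
      then show ?thesis using Suc by (simp add: sum_distrib_left)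
    qed
    have "S \<notin> downs S" by (auto simp: downs_def)
    then have "sum w ((if 0 \<in> A then {S} else {}) \<union> downs S)
        = (if 0 \<in> A then c n m * syt_num m S else 0) + sum w (downs S)"
      using finS by (simp add: w_def m_def)
    then show ?thesis using False c_even[of k m] k down by (simp add: algebra_simps)
  qed
  finally show ?case by (simp add: S_def m_def)
qed

section \<open>Set partitions and their extensions\<close>

definition parts :: "'a set \<Rightarrow> 'a set set set" where
  "parts A = {P. partition_on A P}"

definition extend_blocks :: "'a set \<Rightarrow> ('a \<Rightarrow> 'a set) \<Rightarrow> 'a set set \<Rightarrow> 'a set set" where
  "extend_blocks B f P = (\<lambda>X. X \<union> {y \<in> B. f y = X}) ` P"

lemma finite_parts: "finite A \<Longrightarrow> finite (parts A)"
  by (rule finite_subset[of _ "Pow (Pow A)"]) (auto simp: parts_def partition_on_def)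

lemma finite_part: "finite A \<Longrightarrow> P \<in> parts A \<Longrightarrow> finite P"
  by (rule finite_subset[of _ "Pow A"]) (auto simp: parts_def partition_on_def)

lemma parts_block: "P \<in> parts A \<Longrightarrow> X \<in> P \<Longrightarrow> X \<subseteq> A \<and> X \<noteq> {}"
  by (auto simp: parts_def partition_on_def)

lemma parts_same_block: "P \<in> parts A \<Longrightarrow> X \<in> P \<Longrightarrow> Y \<in> P \<Longrightarrow> x \<in> X \<Longrightarrow> x \<in> Y \<Longrightarrow> X = Y"
  by (auto simp: parts_def partition_on_def disjoint_def)

lemma parts_cover: "P \<in> parts A \<Longrightarrow> x \<in> A \<Longrightarrow> \<exists>X\<in>P. x \<in> X"
  by (auto simp: parts_def partition_on_def)

lemma partsI:
  assumes "\<And>X. X \<in> P \<Longrightarrow> X \<subseteq> A \<and> X \<noteq> {}" "\<And>x. x \<in> A \<Longrightarrow> \<exists>X\<in>P. x \<in> X"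
    "\<And>X Y x. X \<in> P \<Longrightarrow> Y \<in> P \<Longrightarrow> x \<in> X \<Longrightarrow> x \<in> Y \<Longrightarrow> X = Y"
  shows "P \<in> parts A"
  unfolding parts_def mem_Collect_eq
proof (rule partition_onI)
  show "\<Union>P = A" using assms(1,2) by blast
  show "disjnt X Y" if "X \<in> P" "Y \<in> P" "X \<noteq> Y" for X Y
    using assms(3)[OF that(1,2)] that(3) by (auto simp: disjnt_def)
  show "{} \<notin> P" using assms(1) by blast
qed

lemma extended_block_Int:
  assumes "P \<in> parts A" "A \<inter> B = {}" "X \<in> P"
  shows "(X \<union> {y \<in> B. f y = X}) \<inter> A = X"
  using parts_block[OF assms(1,3)] assms(2) by blast

lemma inj_on_extended_block:
  assumes "P \<in> parts A" "A \<inter> B = {}"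
  shows "inj_on (\<lambda>X. X \<union> {y \<in> B. f y = X}) P"
  by (rule inj_on_inverseI[where g = "\<lambda>Y. Y \<inter> A"]) (rule extended_block_Int[OF assms])

lemma card_extend_blocks:
  "P \<in> parts A \<Longrightarrow> A \<inter> B = {} \<Longrightarrow> card (extend_blocks B f P) = card P"
  unfolding extend_blocks_def by (rule card_image) (rule inj_on_extended_block)

text \<open>
  The inverse map cuts all blocks down to \<open>A\<close> and lets \<open>f\<close> remember, for each point of \<open>B\<close>, what
  remains of its block.
\<close>
lemma bij_extend_blocks:
  assumes AB: "A \<inter> B = {}"
  shows "bij_betw (\<lambda>(P, f). extend_blocks B f P) (SIGMA P:parts A. B \<rightarrow>\<^sub>E P)
    {Q \<in> parts (A \<union> B). \<forall>X\<in>Q. X \<inter> A \<noteq> {}}"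
proof (rule bij_betw_imageI)
  show "inj_on (\<lambda>(P, f). extend_blocks B f P) (SIGMA P:parts A. B \<rightarrow>\<^sub>E P)"
  proof (rule inj_onI, clarify)
    fix P f P' f'
    assume P: "P \<in> parts A" "P' \<in> parts A" and f: "f \<in> B \<rightarrow>\<^sub>E P" "f' \<in> B \<rightarrow>\<^sub>E P'"
      and eq: "extend_blocks B f P = extend_blocks B f' P'"
    have restr: "(\<lambda>Y. Y \<inter> A) ` extend_blocks B f P = P" if "P \<in> parts A" for P f
      unfolding extend_blocks_def image_image using extended_block_Int[OF that AB] by simp
    have PP: "P = P'" using restr[OF P(1), of f] restr[OF P(2), of f'] eq by simp
    have "f = f'"
    proof (rule PiE_ext[OF f(1) f(2)[folded PP]])
      fix y assume y: "y \<in> B"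
      then have fy: "f y \<in> P" using f(1) by blast
      then have "f y \<union> {z \<in> B. f z = f y} \<in> extend_blocks B f' P"
        using eq PP unfolding extend_blocks_def by blast
      then obtain X where X: "X \<in> P" "f y \<union> {z \<in> B. f z = f y} = X \<union> {z \<in> B. f' z = X}"
        unfolding extend_blocks_def by blast
      have "f y = X" using extended_block_Int[OF P(1) AB fy, of f] extended_block_Int[OF P(1) AB X(1), of f'] X(2)
        by simp
      moreover have "y \<in> X \<union> {z \<in> B. f' z = X}" using X(2) y by blast
      moreover have "y \<notin> X" using parts_block[OF P(1) X(1)] AB y by blast
      ultimately show "f y = f' y" by simp
    qed
    then show "P = P' \<and> f = f'" using PP by simp
  qed
next
  show "(\<lambda>(P, f). extend_blocks B f P) ` (SIGMA P:parts A. B \<rightarrow>\<^sub>E P)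
      = {Q \<in> parts (A \<union> B). \<forall>X\<in>Q. X \<inter> A \<noteq> {}}"
  proof (intro equalityI subsetI)
    fix Q assume "Q \<in> (\<lambda>(P, f). extend_blocks B f P) ` (SIGMA P:parts A. B \<rightarrow>\<^sub>E P)"
    then obtain P f where P: "P \<in> parts A" and f: "f \<in> B \<rightarrow>\<^sub>E P" and Q: "Q = extend_blocks B f P"
      by auto
    have "Q \<in> parts (A \<union> B)" unfolding Q extend_blocks_def
    proof (rule partsI)
      fix Y assume "Y \<in> (\<lambda>X. X \<union> {y \<in> B. f y = X}) ` P"
      then show "Y \<subseteq> A \<union> B \<and> Y \<noteq> {}" using parts_block[OF P] by blast
    next
      fix x assume "x \<in> A \<union> B"
      then show "\<exists>X\<in>(\<lambda>X. X \<union> {y \<in> B. f y = X}) ` P. x \<in> X"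
      proof (cases "x \<in> A")
        case True
        then obtain X where "X \<in> P" "x \<in> X" using parts_cover[OF P] by metis
        then show ?thesis by (intro bexI[of _ "X \<union> {y \<in> B. f y = X}"]) auto
      next
        case False
        then have "x \<in> B" "f x \<in> P" using \<open>x \<in> A \<union> B\<close> f by auto
        then show ?thesis by (intro bexI[of _ "f x \<union> {y \<in> B. f y = f x}"]) auto
      qed
    next
      fix Y Z x assume "Y \<in> (\<lambda>X. X \<union> {y \<in> B. f y = X}) ` P" "Z \<in> (\<lambda>X. X \<union> {y \<in> B. f y = X}) ` P"
        and x: "x \<in> Y" "x \<in> Z"
      then obtain X X' where X: "X \<in> P" "Y = X \<union> {y \<in> B. f y = X}" "X' \<in> P" "Z = X' \<union> {y \<in> B. f y = X'}"
        by blast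
      have "X = X'"
      proof (cases "x \<in> A")
        case True
        then have "x \<in> X" "x \<in> X'" using x X AB by auto
        then show ?thesis using parts_same_block[OF P X(1) X(3)] by simp
      next
        case False
        then have "f x = X" "f x = X'" using x X parts_block[OF P] by auto
        then show ?thesis by simp
      qed
      then show "Y = Z" using X by simp
    qed
    moreover have "X \<inter> A \<noteq> {}" if "X \<in> Q" for X
      using that parts_block[OF P] unfolding Q extend_blocks_def by blast
    ultimately show "Q \<in> {Q \<in> parts (A \<union> B). \<forall>X\<in>Q. X \<inter> A \<noteq> {}}" by blast
  next
    fix Q assume "Q \<in> {Q \<in> parts (A \<union> B). \<forall>X\<in>Q. X \<inter> A \<noteq> {}}"
    then have Q: "Q \<in> parts (A \<union> B)" and meets: "\<And>X. X \<in> Q \<Longrightarrow> X \<inter> A \<noteq> {}" by auto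
    have "\<forall>y\<in>A \<union> B. \<exists>X. X \<in> Q \<and> y \<in> X" using parts_cover[OF Q] by blast
    then obtain b where b: "\<And>y. y \<in> A \<union> B \<Longrightarrow> b y \<in> Q \<and> y \<in> b y" by metis
    have b_eq: "b y = X" if "X \<in> Q" "y \<in> X" for X y
      using parts_same_block[OF Q _ that(1) _ that(2)] b parts_block[OF Q that(1)] that(2) by blast
    define P where "P = (\<lambda>X. X \<inter> A) ` Q"
    define f where "f = restrict (\<lambda>y. b y \<inter> A) B"
    have "P \<in> parts A" unfolding P_def
    proof (rule partsI)
      fix X Y x assume "X \<in> (\<lambda>X. X \<inter> A) ` Q" "Y \<in> (\<lambda>X. X \<inter> A) ` Q" "x \<in> X" "x \<in> Y"
      then show "X = Y" using parts_same_block[OF Q] by blast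
    qed (use meets parts_cover[OF Q] in auto)
    moreover have "f \<in> B \<rightarrow>\<^sub>E P" using b by (auto simp: f_def P_def)
    moreover have "extend_blocks B f P = Q"
    proof -
      have "X \<inter> A \<union> {y \<in> B. f y = X \<inter> A} = X" if X: "X \<in> Q" for X
      proof -
        have "f y = X \<inter> A \<longleftrightarrow> y \<in> X" if y: "y \<in> B" for y
        proof
          assume "f y = X \<inter> A"
          then have "b y \<inter> A = X \<inter> A" using y by (simp add: f_def)
          moreover obtain x where "x \<in> X \<inter> A" using meets[OF X] by blast
          ultimately have "b y = X" using parts_same_block[OF Q, of "b y" X x] b[of y] X y by blast
          then show "y \<in> X" using b[of y] y by blast
        next
          assume "y \<in> X"
          then show "f y = X \<inter> A" using b_eq[OF X] y by (simp add: f_def)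
        qed
        then show ?thesis using parts_block[OF Q X] by blast
      qed
      then show ?thesis unfolding extend_blocks_def P_def image_image by simp
    qed
    ultimately show "Q \<in> (\<lambda>(P, f). extend_blocks B f P) ` (SIGMA P:parts A. B \<rightarrow>\<^sub>E P)" by force
  qed
qed

lemma sum_extend_blocks:
  fixes F :: "'a set set \<Rightarrow> nat"
  assumes "finite A" "finite B" "A \<inter> B = {}"
  shows "(\<Sum>Q | Q \<in> parts (A \<union> B) \<and> (\<forall>X\<in>Q. X \<inter> A \<noteq> {}). F Q)
    = (\<Sum>P\<in>parts A. \<Sum>f\<in>B \<rightarrow>\<^sub>E P. F (extend_blocks B f P))"
proof -
  have "(\<Sum>P\<in>parts A. \<Sum>f\<in>B \<rightarrow>\<^sub>E P. F (extend_blocks B f P))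
      = (\<Sum>(P, f)\<in>(SIGMA P:parts A. B \<rightarrow>\<^sub>E P). F (extend_blocks B f P))"
    using assms finite_parts finite_part by (intro sum.Sigma) (auto intro!: finite_PiE)
  then show ?thesis
    using sum.reindex_bij_betw[OF bij_extend_blocks[OF assms(3)], of F] by (simp add: case_prod_unfold)
qed

lemma card_extensions:
  assumes "finite A" "finite B" "A \<inter> B = {}"
  shows "card {Q \<in> parts (A \<union> B). (\<forall>X\<in>Q. X \<inter> A \<noteq> {}) \<and> C Q}
    = (\<Sum>P\<in>parts A. card {f \<in> B \<rightarrow>\<^sub>E P. C (extend_blocks B f P)})"
proof -
  have fin: "finite (parts (A \<union> B))" "\<And>P. P \<in> parts A \<Longrightarrow> finite (B \<rightarrow>\<^sub>E P)"
    using assms finite_parts[of "A \<union> B"] finite_part[of A] by (auto intro: finite_PiE)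
  have "card {Q \<in> parts (A \<union> B). (\<forall>X\<in>Q. X \<inter> A \<noteq> {}) \<and> C Q}
      = (\<Sum>Q | Q \<in> parts (A \<union> B) \<and> (\<forall>X\<in>Q. X \<inter> A \<noteq> {}). if C Q then 1 else 0)"
    using fin by (simp add: sum.If_cases Int_def conj_assoc)
  also have "\<dots> = (\<Sum>P\<in>parts A. \<Sum>f\<in>B \<rightarrow>\<^sub>E P. if C (extend_blocks B f P) then 1 else 0)"
    by (rule sum_extend_blocks[OF assms])
  also have "\<dots> = (\<Sum>P\<in>parts A. card {f \<in> B \<rightarrow>\<^sub>E P. C (extend_blocks B f P)})"
    using fin by (intro sum.cong refl) (simp add: sum.If_cases Int_def)
  finally show ?thesis .
qed

lemma bij_insert_singleton:
  assumes x: "x \<notin> A"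
  shows "bij_betw (insert {x}) (parts A) {Q \<in> parts (insert x A). {x} \<in> Q}"
proof (rule bij_betw_byWitness[where f' = "\<lambda>Q. Q - {{x}}"])
  have notin: "{x} \<notin> P" if "P \<in> parts A" for P using parts_block[OF that] x by blast
  show "\<forall>P\<in>parts A. insert {x} P - {{x}} = P" using notin by blast
  show "\<forall>Q\<in>{Q \<in> parts (insert x A). {x} \<in> Q}. insert {x} (Q - {{x}}) = Q" by blast
  show "insert {x} ` parts A \<subseteq> {Q \<in> parts (insert x A). {x} \<in> Q}"
  proof (rule image_subsetI)
    fix P assume P: "P \<in> parts A"
    have "insert {x} P \<in> parts (insert x A)"
    proof (rule partsI)
      fix X Y z assume "X \<in> insert {x} P" "Y \<in> insert {x} P" "z \<in> X" "z \<in> Y"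
      then show "X = Y" using parts_same_block[OF P, of X Y z] parts_block[OF P] x by blast
    qed (use parts_block[OF P] parts_cover[OF P] in auto)
    then show "insert {x} P \<in> {Q \<in> parts (insert x A). {x} \<in> Q}" by simp
  qed
  show "(\<lambda>Q. Q - {{x}}) ` {Q \<in> parts (insert x A). {x} \<in> Q} \<subseteq> parts A"
  proof (rule image_subsetI)
    fix Q assume "Q \<in> {Q \<in> parts (insert x A). {x} \<in> Q}"
    then have Q: "Q \<in> parts (insert x A)" "{x} \<in> Q" by auto
    have x_only: "X = {x}" if "X \<in> Q" "x \<in> X" for X using parts_same_block[OF Q(1) that(1) Q(2)] that(2) by blast
    show "Q - {{x}} \<in> parts A"
    proof (rule partsI)
      fix X assume "X \<in> Q - {{x}}"
      then show "X \<subseteq> A \<and> X \<noteq> {}" using parts_block[OF Q(1)] x_only by blast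
    next
      fix z assume "z \<in> A"
      then show "\<exists>X\<in>Q - {{x}}. z \<in> X" using parts_cover[OF Q(1), of z] x by blast
    next
      fix X Y z assume "X \<in> Q - {{x}}" "Y \<in> Q - {{x}}" "z \<in> X" "z \<in> Y"
      then show "X = Y" using parts_same_block[OF Q(1)] by blast
    qed
  qed
qed

text \<open>
  The new point either forms a block of its own or joins one of the blocks that are already there.
\<close>
lemma sum_parts_insert:
  fixes F :: "nat \<Rightarrow> nat"
  assumes "finite A" "x \<notin> A"
  shows "(\<Sum>Q\<in>parts (insert x A). F (card Q))
    = (\<Sum>P\<in>parts A. F (Suc (card P)) + card P * F (card P))"
proof -
  let ?Q = "parts (insert x A)"
  have fin: "finite ?Q" using assms(1) by (simp add: finite_parts)
  have "{x} \<notin> P" if "P \<in> parts A" for P using parts_block[OF that] assms(2) by blast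
  then have "(\<Sum>P\<in>parts A. F (card (insert {x} P))) = (\<Sum>P\<in>parts A. F (Suc (card P)))"
    using finite_part[OF assms(1)] by (intro sum.cong) simp_all
  then have single: "(\<Sum>Q | Q \<in> ?Q \<and> {x} \<in> Q. F (card Q)) = (\<Sum>P\<in>parts A. F (Suc (card P)))"
    using sum.reindex_bij_betw[OF bij_insert_singleton[OF assms(2)], of "\<lambda>Q. F (card Q)"] by simp
  \<comment> \<open>the other set partitions are the extensions by the set \<open>{x}\<close>\<close>
  have iff: "{x} \<notin> Q \<longleftrightarrow> (\<forall>X\<in>Q. X \<inter> A \<noteq> {})" if Q: "Q \<in> ?Q" for Q
  proof
    assume "{x} \<notin> Q"
    show "\<forall>X\<in>Q. X \<inter> A \<noteq> {}"
    proof
      fix X assume "X \<in> Q"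
      then have "X \<subseteq> insert x A" "X \<noteq> {}" "X \<noteq> {x}" using parts_block[OF Q] \<open>{x} \<notin> Q\<close> by auto
      then show "X \<inter> A \<noteq> {}" by blast
    qed
  qed (use assms(2) in blast)
  have "(\<Sum>Q | Q \<in> ?Q \<and> {x} \<notin> Q. F (card Q))
      = (\<Sum>Q | Q \<in> parts (A \<union> {x}) \<and> (\<forall>X\<in>Q. X \<inter> A \<noteq> {}). F (card Q))"
    using iff by (intro sum.cong) auto
  also have "\<dots> = (\<Sum>P\<in>parts A. \<Sum>f\<in>{x} \<rightarrow>\<^sub>E P. F (card (extend_blocks {x} f P)))"
    using assms by (intro sum_extend_blocks) auto
  also have "\<dots> = (\<Sum>P\<in>parts A. card P * F (card P))"
    using assms(2) by (intro sum.cong refl) (simp add: card_extend_blocks card_funcsetE)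
  finally have join: "(\<Sum>Q | Q \<in> ?Q \<and> {x} \<notin> Q. F (card Q)) = (\<Sum>P\<in>parts A. card P * F (card P))" .
  have "(\<Sum>Q\<in>?Q. F (card Q)) = (\<Sum>Q | Q \<in> ?Q \<and> {x} \<in> Q. F (card Q)) + (\<Sum>Q | Q \<in> ?Q \<and> {x} \<notin> Q. F (card Q))"
    using sum.Int_Diff[OF fin, of "\<lambda>Q. F (card Q)" "{Q. {x} \<in> Q}"]
    by (simp add: Int_def set_diff_eq)
  then show ?thesis by (simp add: single join sum.distrib)
qed

lemma parts_empty: "parts {} = {{}}"
  by (auto simp: parts_def partition_on_def)

lemma sum_parts_Suc:
  fixes F :: "nat \<Rightarrow> nat"
  shows "(\<Sum>Q\<in>parts {1..Suc n}. F (card Q))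
    = (\<Sum>P\<in>parts {1..n}. F (Suc (card P)) + card P * F (card P))"
  using sum_parts_insert[of "{1..n}" "Suc n" F] by (simp add: atLeastAtMostSuc_conv)

text \<open>
  The function \<open>F\<close> is arbitrary so that the induction can run through \<open>sum_parts_Suc\<close>, which changes
  it. For the indicator function of a single number this is the description of \<open>Stirling n j\<close> as the
  number of set partitions into \<open>j\<close> blocks.
\<close>
lemma sum_parts_Stirling:
  fixes F :: "nat \<Rightarrow> nat"
  shows "(\<Sum>P\<in>parts {1..n}. F (card P)) = (\<Sum>j\<le>n. Stirling n j * F j)"
proof (induction n arbitrary: F)
  case 0
  then show ?case by (simp add: parts_empty)
next
  case (Suc n)
  have "(\<Sum>P\<in>parts {1..Suc n}. F (card P)) = (\<Sum>j\<le>n. Stirling n j * (F (Suc j) + j * F j))"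
    unfolding sum_parts_Suc by (rule Suc.IH[of "\<lambda>p. F (Suc p) + p * F p"])
  also have "\<dots> = (\<Sum>j\<le>n. Stirling n j * F (Suc j)) + (\<Sum>j\<le>n. Stirling n j * (j * F j))"
    by (simp add: sum.distrib algebra_simps)
  also have "(\<Sum>j\<le>n. Stirling n j * (j * F j)) = (\<Sum>j\<le>Suc n. Stirling n j * (j * F j))"
    by simp
  also have "\<dots> = (\<Sum>j\<le>n. Stirling n (Suc j) * (Suc j * F (Suc j)))"
    by (subst sum.atMost_Suc_shift) simp
  also have "(\<Sum>j\<le>n. Stirling n j * F (Suc j)) + \<dots> = (\<Sum>j\<le>n. Stirling (Suc n) (Suc j) * F (Suc j))"
    by (simp add: sum.distrib[symmetric] algebra_simps)
  also have "\<dots> = (\<Sum>j\<le>Suc n. Stirling (Suc n) j * F j)"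
    by (subst sum.atMost_Suc_shift) simp
  finally show ?case .
qed

section \<open>Powers and surjections in terms of Stirling numbers\<close>

text \<open>
  Removing \<open>x\<close> from the domain leaves a map onto either all of \<open>C\<close> or all of \<open>C\<close> except the value at
  \<open>x\<close>. This is the Stirling recurrence multiplied by the factorial.
\<close>
lemma card_surj:
  assumes "finite B" "finite C"
  shows "card {f \<in> B \<rightarrow>\<^sub>E C. f ` B = C} = fact (card C) * Stirling (card B) (card C)"
  using assms
proof (induction B arbitrary: C rule: finite_induct)
  case empty
  then show ?case by (cases "C = {}"; cases "card C") auto
next
  case (insert x B)
  let ?S = "\<lambda>D. {f \<in> B \<rightarrow>\<^sub>E D. f ` B = D}"
  have finS: "finite (?S D)" if "finite D" for D
    using finite_PiE[OF insert.hyps(1), of "\<lambda>_. D"] that by simp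
  have "{f \<in> insert x B \<rightarrow>\<^sub>E C. f ` insert x B = C}
      = (\<lambda>(c, g). g(x := c)) ` (SIGMA c:C. ?S C \<union> ?S (C - {c}))"
  proof (intro equalityI subsetI)
    fix f assume "f \<in> {f \<in> insert x B \<rightarrow>\<^sub>E C. f ` insert x B = C}"
    then have f: "f \<in> insert x B \<rightarrow>\<^sub>E C" "insert (f x) (f ` B) = C" by auto
    then obtain c g where cg: "c \<in> C" "g \<in> B \<rightarrow>\<^sub>E C" "f = g(x := c)"
      unfolding PiE_insert_eq by auto
    have im: "f ` B = g ` B" using cg(3) insert.hyps(2) by auto
    have "g ` B = C \<or> g ` B = C - {c}" using f(2) im cg by auto
    then have "g \<in> ?S C \<union> ?S (C - {c})" using cg(2) by (auto simp: PiE_iff)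
    then show "f \<in> (\<lambda>(c, g). g(x := c)) ` (SIGMA c:C. ?S C \<union> ?S (C - {c}))" using cg by force
  next
    fix f assume "f \<in> (\<lambda>(c, g). g(x := c)) ` (SIGMA c:C. ?S C \<union> ?S (C - {c}))"
    then obtain c g where cg: "c \<in> C" "g \<in> ?S C \<union> ?S (C - {c})" "f = g(x := c)" by auto
    have g: "g \<in> B \<rightarrow>\<^sub>E C" "insert c (g ` B) = C" using cg by auto
    have "f ` insert x B = C" using g(2) insert.hyps(2) cg(3) by auto
    moreover have "f \<in> insert x B \<rightarrow>\<^sub>E C" unfolding PiE_insert_eq
      by (rule image_eqI[of _ _ "(c, g)"]) (use cg g in simp_all)
    ultimately show "f \<in> {f \<in> insert x B \<rightarrow>\<^sub>E C. f ` insert x B = C}" by blast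
  qed
  moreover have "inj_on (\<lambda>(c, g). g(x := c)) (SIGMA c:C. ?S C \<union> ?S (C - {c}))"
  proof (rule inj_on_inverseI[where g = "\<lambda>f. (f x, f(x := undefined))"])
    fix z assume "z \<in> (SIGMA c:C. ?S C \<union> ?S (C - {c}))"
    then obtain c g where z: "z = (c, g)" and g: "g \<in> ?S C \<union> ?S (C - {c})" by blast
    have "g x = undefined" using g insert.hyps(2) by (auto simp: PiE_def extensional_def)
    then show "(\<lambda>f. (f x, f(x := undefined))) (case z of (c, g) \<Rightarrow> g(x := c)) = z" using z by auto
  qed
  ultimately have "card {f \<in> insert x B \<rightarrow>\<^sub>E C. f ` insert x B = C}
      = card (SIGMA c:C. ?S C \<union> ?S (C - {c}))"
    by (simp add: card_image)
  also have "\<dots> = (\<Sum>c\<in>C. card (?S C \<union> ?S (C - {c})))"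
    using insert.prems finS by (intro card_SigmaI) auto
  also have "\<dots> = (\<Sum>c\<in>C. fact (card C) * Stirling (card B) (card C)
      + fact (card C - 1) * Stirling (card B) (card C - 1))"
  proof (rule sum.cong[OF refl])
    fix c assume c: "c \<in> C"
    then have "?S C \<inter> ?S (C - {c}) = {}" by auto
    then have "card (?S C \<union> ?S (C - {c})) = card (?S C) + card (?S (C - {c}))"
      using finS insert.prems by (intro card_Un_disjoint) auto
    then show "card (?S C \<union> ?S (C - {c})) = fact (card C) * Stirling (card B) (card C)
      + fact (card C - 1) * Stirling (card B) (card C - 1)"
      using insert.IH[OF insert.prems] insert.IH[of "C - {c}"] insert.prems c by simp
  qed
  also have "\<dots> = fact (card C) * Stirling (card (insert x B)) (card C)"
    using insert.hyps by (cases "card C") (simp_all add: algebra_simps)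
  finally show ?case .
qed

text \<open>
  With the falling factorial \<open>(p)_j\<close> written as \<open>j!\<close> times a binomial coefficient, this is
  \<open>p (p)_j = (p)_(j+1) + j (p)_j\<close>, the source of the Stirling recurrence in \<open>power_Stirling\<close>.
\<close>
lemma mult_falling_factorial: "p * (fact j * (p choose j)) = fact (Suc j) * (p choose Suc j) + j * (fact j * (p choose j))"
proof (cases "j \<le> p")
  case True
  have "Suc j * (p choose Suc j) = (p - j) * (p choose j)"
    by (simp only: binomial_absorb_comp binomial_absorption)
  then have "p * (p choose j) = Suc j * (p choose Suc j) + j * (p choose j)"
    using True by (metis add_mult_distrib le_add_diff_inverse2)
  then have "fact j * (p * (p choose j)) = fact j * (Suc j * (p choose Suc j) + j * (p choose j))"
    by (rule arg_cong)
  then show ?thesis by (simp add: algebra_simps)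
qed (simp add: binomial_eq_0)

lemma power_Stirling:
  "p ^ n = (\<Sum>j\<le>n. fact j * (p choose j) * Stirling n j)" for p :: nat
proof (induction n)
  case (Suc n)
  let ?h = "\<lambda>j. fact j * (p choose j)"
  have "p ^ Suc n = (\<Sum>j\<le>n. (p * ?h j) * Stirling n j)"
    using Suc.IH by (simp add: sum_distrib_left algebra_simps)
  also have "\<dots> = (\<Sum>j\<le>n. ?h (Suc j) * Stirling n j) + (\<Sum>j\<le>n. j * ?h j * Stirling n j)"
    unfolding mult_falling_factorial by (simp only: add_mult_distrib sum.distrib)
  also have "(\<Sum>j\<le>n. j * ?h j * Stirling n j) = (\<Sum>j\<le>Suc n. j * ?h j * Stirling n j)"
    by simp
  also have "\<dots> = (\<Sum>j\<le>n. Suc j * ?h (Suc j) * Stirling n (Suc j))"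
    by (subst sum.atMost_Suc_shift) simp
  also have "(\<Sum>j\<le>n. ?h (Suc j) * Stirling n j) + \<dots> = (\<Sum>j\<le>n. ?h (Suc j) * Stirling (Suc n) (Suc j))"
    by (simp add: sum.distrib[symmetric] algebra_simps)
  also have "\<dots> = (\<Sum>j\<le>Suc n. ?h j * Stirling (Suc n) j)"
    by (subst sum.atMost_Suc_shift) simp
  finally show ?case .
qed simp

text \<open>
  Obtained from \<open>power_Stirling\<close> for the exponent \<open>n+1\<close> by cancelling a factor \<open>p+1\<close>.
\<close>
lemma power_Suc_Stirling:
  "Suc p ^ n = (\<Sum>j\<le>n. fact j * (p choose j) * Stirling (Suc n) (Suc j))"
proof -
  have "Suc p * Suc p ^ n = (\<Sum>j\<le>Suc n. fact j * (Suc p choose j) * Stirling (Suc n) j)"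
    using power_Stirling[of "Suc p" "Suc n"] by simp
  also have "\<dots> = (\<Sum>j\<le>n. fact (Suc j) * (Suc p choose Suc j) * Stirling (Suc n) (Suc j))"
    by (subst sum.atMost_Suc_shift) simp
  also have "\<dots> = (\<Sum>j\<le>n. Suc p * (fact j * (p choose j) * Stirling (Suc n) (Suc j)))"
  proof (rule sum.cong[OF refl])
    fix j
    have "fact (Suc j) * (Suc p choose Suc j) = fact j * (Suc j * (Suc p choose Suc j))"
      by (simp add: algebra_simps)
    also have "\<dots> = fact j * (Suc p * (p choose j))" by (simp only: Suc_times_binomial)
    finally show "fact (Suc j) * (Suc p choose Suc j) * Stirling (Suc n) (Suc j)
        = Suc p * (fact j * (p choose j) * Stirling (Suc n) (Suc j))" by (simp only: ac_simps)
  qed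
  finally show ?thesis by (simp only: sum_distrib_left[symmetric] mult_cancel1) simp
qed

section \<open>Counting set partitions by their restriction to an initial interval\<close>

lemma card_blocks_avoiding:
  assumes "finite A" "P \<in> parts A" "x \<in> A"
  shows "card {X \<in> P. x \<notin> X} = card P - 1"
proof -
  obtain X where X: "X \<in> P" "x \<in> X" using parts_cover[OF assms(2,3)] by metis
  then have "{X \<in> P. x \<notin> X} = P - {X}" using parts_same_block[OF assms(2)] by blast
  then show ?thesis using X(1) by simp
qed

lemma card_parts_pos: "finite A \<Longrightarrow> P \<in> parts A \<Longrightarrow> A \<noteq> {} \<Longrightarrow> card P > 0"
  using finite_part[of A P] parts_cover[of P A] by (auto simp: card_gt_0_iff)

lemma B_num_eq_sum: "B_num k j = (\<Sum>P\<in>parts {1..k}. card P choose j)"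
proof -
  have fin: "finite P" if "P \<in> parts {1..k}" for P using finite_part[OF _ that] by simp
  have "{(P, A). partition_on {1..k} P \<and> A \<subseteq> P \<and> card A = j}
      = (SIGMA P:parts {1..k}. {A. A \<subseteq> P \<and> card A = j})" by (auto simp: parts_def)
  then have "B_num k j = (\<Sum>P\<in>parts {1..k}. card {A. A \<subseteq> P \<and> card A = j})"
    unfolding B_num_def using fin finite_parts[of "{1..k}"]
    by (simp add: card_SigmaI finite_subset[of _ "Pow _"])
  then show ?thesis using fin by (simp add: n_subsets)
qed

text \<open>
  Exactly one block contains the largest point, so the marked blocks are chosen from all but one.
\<close>
lemma B_tilde_eq_sum: "B_tilde (Suc k) j = (\<Sum>P\<in>parts {1..Suc k}. card P - 1 choose j)"
proof -
  let ?av = "\<lambda>P. {X \<in> P. Suc k \<notin> X}"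
  have fin: "finite (?av P)" if "P \<in> parts {1..Suc k}" for P using finite_part[OF _ that] by simp
  have "{(P, A). partition_on {1..Suc k} P \<and> A \<subseteq> P \<and> card A = j \<and> (\<forall>X\<in>A. Suc k \<notin> X)}
      = (SIGMA P:parts {1..Suc k}. {A. A \<subseteq> ?av P \<and> card A = j})" by (auto simp: parts_def)
  then have "B_tilde (Suc k) j = (\<Sum>P\<in>parts {1..Suc k}. card {A. A \<subseteq> ?av P \<and> card A = j})"
    unfolding B_tilde_def using fin finite_parts[of "{1..Suc k}"]
    by (simp only:) (rule card_SigmaI, auto intro: finite_subset[of _ "Pow (?av _)"])
  also have "\<dots> = (\<Sum>P\<in>parts {1..Suc k}. card (?av P) choose j)"
    using fin by (intro sum.cong refl n_subsets)
  also have "\<dots> = (\<Sum>P\<in>parts {1..Suc k}. card P - 1 choose j)"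
    by (intro sum.cong refl arg_cong2[where f = binomial] card_blocks_avoiding) auto
  finally show ?thesis .
qed

lemma B_num_0: "B_num 0 j = (if j = 0 then 1 else 0)"
  by (simp add: B_num_eq_sum parts_empty)

text \<open>
  This and \<open>B_num_Suc\<close> are the recurrences that the coefficients of the simplified tableaux satisfy.
\<close>
lemma B_tilde_Suc: "B_tilde (Suc k) j = B_num k j + Suc j * B_num k (Suc j)"
  unfolding B_tilde_eq_sum sum_parts_Suc[of "\<lambda>p. p - 1 choose j"] B_num_eq_sum
  by (simp only: sum.distrib sum_distrib_left diff_Suc_1 binomial_absorption)

lemma B_num_Suc: "B_num (Suc k) j = B_tilde (Suc k) j + (if j = 0 then 0 else B_tilde (Suc k) (j - 1))"
proof (cases j)
  case (Suc i)
  have "(card P choose Suc i) = (card P - 1 choose Suc i) + (card P - 1 choose i)"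
    if "P \<in> parts {1..Suc k}" for P
    using card_parts_pos[OF _ that] by (cases "card P") auto
  then show ?thesis using Suc by (simp add: B_num_eq_sum B_tilde_eq_sum sum.distrib)
qed (simp add: B_num_eq_sum B_tilde_eq_sum)

lemma sum_B_num_Stirling: "(\<Sum>j\<le>n. fact j * B_num k j * Stirling n j) = (\<Sum>P\<in>parts {1..k}. card P ^ n)"
  unfolding B_num_eq_sum power_Stirling sum_distrib_left sum_distrib_right by (rule sum.swap)

lemma sum_B_num_Stirling_Suc:
  "(\<Sum>j\<le>n. fact j * B_num k j * Stirling (Suc n) (Suc j)) = (\<Sum>P\<in>parts {1..k}. Suc (card P) ^ n)"
  unfolding B_num_eq_sum power_Suc_Stirling sum_distrib_left sum_distrib_right by (rule sum.swap)

lemma sum_B_tilde_Stirling: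
  "(\<Sum>j\<le>n. fact j * B_tilde (Suc k) j * Stirling n j) = (\<Sum>P\<in>parts {1..Suc k}. (card P - 1) ^ n)"
  unfolding B_tilde_eq_sum power_Stirling sum_distrib_left sum_distrib_right by (rule sum.swap)

lemma sum_B_tilde_Stirling_Suc:
  "(\<Sum>j\<le>n. fact j * B_tilde (Suc k) j * Stirling (Suc n) (Suc j)) = (\<Sum>P\<in>parts {1..Suc k}. card P ^ n)"
proof -
  have "(\<Sum>j\<le>n. fact j * B_tilde (Suc k) j * Stirling (Suc n) (Suc j))
      = (\<Sum>P\<in>parts {1..Suc k}. Suc (card P - 1) ^ n)"
    unfolding B_tilde_eq_sum power_Suc_Stirling sum_distrib_left sum_distrib_right by (rule sum.swap)
  also have "\<dots> = (\<Sum>P\<in>parts {1..Suc k}. card P ^ n)"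
    using card_parts_pos[of "{1..Suc k}"] by (intro sum.cong refl) simp
  finally show ?thesis .
qed

text \<open>
  A block has its minimum in the initial interval if and only if it meets that interval, so
  \<open>card_extensions\<close> applies.
\<close>
lemma card_partitions_min_le_such_that:
  "card {Q. partition_on {1..m + n} Q \<and> (\<forall>X\<in>Q. Min X \<le> m) \<and> C Q}
    = (\<Sum>P\<in>parts {1..m}. card {f \<in> {Suc m..m + n} \<rightarrow>\<^sub>E P. C (extend_blocks {Suc m..m + n} f P)})"
proof -
  have U: "{1..m + n} = {1..m} \<union> {Suc m..m + n}" by auto
  have "Min X \<le> m \<longleftrightarrow> X \<inter> {1..m} \<noteq> {}" if Q: "Q \<in> parts {1..m + n}" "X \<in> Q" for Q X
  proof -
    have X: "X \<subseteq> {1..m + n}" "X \<noteq> {}" using parts_block[OF Q] by auto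
    then have "Min X \<le> m \<longleftrightarrow> (\<exists>x\<in>X. x \<le> m)" using finite_subset by (intro Min_le_iff) auto
    also have "\<dots> \<longleftrightarrow> X \<inter> {1..m} \<noteq> {}"
    proof -
      have "x \<in> {1..m} \<longleftrightarrow> x \<le> m" if "x \<in> X" for x using X(1) that by auto
      then show ?thesis by blast
    qed
    finally show ?thesis .
  qed
  then have "{Q. partition_on {1..m + n} Q \<and> (\<forall>X\<in>Q. Min X \<le> m) \<and> C Q}
      = {Q \<in> parts {1..m + n}. (\<forall>X\<in>Q. X \<inter> {1..m} \<noteq> {}) \<and> C Q}"
    by (auto simp: parts_def)
  then show ?thesis unfolding U using card_extensions[of "{1..m}" "{Suc m..m + n}" C] by simp
qed

text \<open>
  This translates conditions on an extended block into conditions on the block \<open>X\<close> of the initial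
  interval and on whether a new point has joined it.
\<close>
lemma extended_block_extrema:
  fixes m :: nat
  assumes X: "X \<subseteq> {1..m} \<and> X \<noteq> {}" and B: "B = {Suc m..m + n}"
  shows "m \<in> X \<union> {y \<in> B. f y = X} \<longleftrightarrow> m \<in> X"
    and "Max (X \<union> {y \<in> B. f y = X}) = m \<longleftrightarrow> m \<in> X \<and> X \<notin> f ` B"
    and "m \<le> Max (X \<union> {y \<in> B. f y = X}) \<longleftrightarrow> m \<in> X \<or> X \<in> f ` B"
    and "Min (X \<union> {y \<in> B. f y = X}) = m \<longleftrightarrow> X = {m}"
proof -
  define Y where "Y = X \<union> {y \<in> B. f y = X}"
  have low: "x \<le> m" and low': "m \<le> x \<Longrightarrow> x = m" if "x \<in> X" for x using X that by auto
  have high: "\<not> y \<le> m" and high': "m \<le> y" if "y \<in> B" for y using B that by auto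
  have in_Y: "y \<in> Y \<longleftrightarrow> y \<in> X \<or> (y \<in> B \<and> f y = X)" for y by (auto simp: Y_def)
  have "finite X" using X finite_subset by blast
  then have fin: "finite Y" "Y \<noteq> {}" using X B by (auto simp: Y_def)
  have m: "m \<in> Y \<longleftrightarrow> m \<in> X" using in_Y high by blast
  have "Max Y = m \<longleftrightarrow> m \<in> Y \<and> (\<forall>y\<in>Y. y \<le> m)" by (rule Max_eq_iff[OF fin])
  also have "(\<forall>y\<in>Y. y \<le> m) \<longleftrightarrow> X \<notin> f ` B" using in_Y low high by blast
  finally show "Max (X \<union> {y \<in> B. f y = X}) = m \<longleftrightarrow> m \<in> X \<and> X \<notin> f ` B" using m unfolding Y_def by simp
  have "m \<le> Max Y \<longleftrightarrow> (\<exists>y\<in>Y. m \<le> y)" by (rule Max_ge_iff[OF fin])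
  also have "\<dots> \<longleftrightarrow> m \<in> X \<or> X \<in> f ` B" using in_Y low' high' by blast
  finally show "m \<le> Max (X \<union> {y \<in> B. f y = X}) \<longleftrightarrow> m \<in> X \<or> X \<in> f ` B" unfolding Y_def .
  have "Min Y = m \<longleftrightarrow> m \<in> Y \<and> (\<forall>y\<in>Y. m \<le> y)" by (rule Min_eq_iff[OF fin])
  also have "\<dots> \<longleftrightarrow> X = {m}"
  proof
    assume *: "m \<in> Y \<and> (\<forall>y\<in>Y. m \<le> y)"
    have "y = m" if "y \<in> X" for y using * in_Y[of y] low'[OF that] that by simp
    then show "X = {m}" using * m by auto
  next
    assume "X = {m}"
    then have "m \<in> Y" "m \<le> y" if "y \<in> Y" for y using m in_Y[of y] high'[of y] that by auto
    then show "m \<in> Y \<and> (\<forall>y\<in>Y. m \<le> y)" using \<open>X = {m}\<close> m by auto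
  qed
  finally show "Min (X \<union> {y \<in> B. f y = X}) = m \<longleftrightarrow> X = {m}" unfolding Y_def .
  show "m \<in> X \<union> {y \<in> B. f y = X} \<longleftrightarrow> m \<in> X" using m unfolding Y_def .
qed

lemma ball_extend_blocks: "(\<forall>Y\<in>extend_blocks B f P. R Y) \<longleftrightarrow> (\<forall>X\<in>P. R (X \<union> {y \<in> B. f y = X}))"
  by (simp add: extend_blocks_def)

lemma card_partitions_min_le:
  "card {Q. partition_on {1..m + n} Q \<and> (\<forall>X\<in>Q. Min X \<le> m)} = (\<Sum>P\<in>parts {1..m}. card P ^ n)"
  using card_partitions_min_le_such_that[of m n "\<lambda>_. True"] by (simp add: card_funcsetE)

text \<open>
  No new point may join the block of \<open>m\<close>, which leaves \<open>card P - 1\<close> choices for each of them.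
\<close>
lemma card_partitions_max_in_block:
  assumes m: "m \<ge> 1"
  shows "card {Q. partition_on {1..m + n} Q \<and> (\<forall>X\<in>Q. Min X \<le> m) \<and> (\<forall>X\<in>Q. m \<in> X \<longrightarrow> Max X = m)}
    = (\<Sum>P\<in>parts {1..m}. (card P - 1) ^ n)"
  unfolding card_partitions_min_le_such_that
proof (rule sum.cong[OF refl])
  fix P assume P: "P \<in> parts {1..m}"
  let ?B = "{Suc m..m + n}"
  note ex = extended_block_extrema[OF parts_block[OF P] refl, of _ n]
  have iff: "(\<forall>X\<in>extend_blocks ?B f P. m \<in> X \<longrightarrow> Max X = m) \<longleftrightarrow> (\<forall>X\<in>P. m \<in> X \<longrightarrow> X \<notin> f ` ?B)" for f
    unfolding ball_extend_blocks ball_conj_distrib[symmetric]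
      by (intro ball_cong refl) (auto simp only: ex)
  have "f \<in> ?B \<rightarrow>\<^sub>E P \<and> (\<forall>X\<in>P. m \<in> X \<longrightarrow> X \<notin> f ` ?B) \<longleftrightarrow> f \<in> ?B \<rightarrow>\<^sub>E {X \<in> P. m \<notin> X}" for f
    unfolding PiE_iff by blast
  then have "{f \<in> ?B \<rightarrow>\<^sub>E P. \<forall>X\<in>extend_blocks ?B f P. m \<in> X \<longrightarrow> Max X = m} = ?B \<rightarrow>\<^sub>E {X \<in> P. m \<notin> X}"
    unfolding iff by blast
  moreover have "card {X \<in> P. m \<notin> X} = card P - 1" using card_blocks_avoiding[OF _ P, of m] m by simp
  ultimately show "card {f \<in> ?B \<rightarrow>\<^sub>E P. \<forall>X\<in>extend_blocks ?B f P. m \<in> X \<longrightarrow> Max X = m} = (card P - 1) ^ n"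
    by (simp add: card_funcsetE)
qed

text \<open>
  The condition says that \<open>Suc k\<close> is a singleton block of the restriction, so the restriction is a set
  partition of \<open>{1..k}\<close> with one block added.
\<close>
lemma card_partitions_min_in_block:
  "card {Q. partition_on {1..Suc k + n} Q \<and> (\<forall>X\<in>Q. Min X \<le> Suc k) \<and> (\<forall>X\<in>Q. Suc k \<in> X \<longrightarrow> Min X = Suc k)}
    = (\<Sum>P\<in>parts {1..k}. Suc (card P) ^ n)"
proof -
  let ?m = "Suc k" and ?B = "{Suc (Suc k)..Suc k + n}"
  have "card {f \<in> ?B \<rightarrow>\<^sub>E P. \<forall>X\<in>extend_blocks ?B f P. ?m \<in> X \<longrightarrow> Min X = ?m}
      = (if {?m} \<in> P then card P ^ n else 0)" if P: "P \<in> parts {1..?m}" for P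
  proof -
    note ex = extended_block_extrema[OF parts_block[OF P] refl, of _ n]
    have "(\<forall>X\<in>extend_blocks ?B f P. ?m \<in> X \<longrightarrow> Min X = ?m) \<longleftrightarrow> (\<forall>X\<in>P. ?m \<in> X \<longrightarrow> X = {?m})" for f
      unfolding ball_extend_blocks ball_conj_distrib[symmetric]
      by (intro ball_cong refl) (auto simp only: ex)
    moreover have "(\<forall>X\<in>P. ?m \<in> X \<longrightarrow> X = {?m}) \<longleftrightarrow> {?m} \<in> P"
      using parts_same_block[OF P, of _ "{?m}" ?m] parts_cover[OF P, of ?m] by auto
    ultimately show ?thesis by (simp add: card_funcsetE)
  qed
  then have "card {Q. partition_on {1..Suc k + n} Q \<and> (\<forall>X\<in>Q. Min X \<le> ?m) \<and> (\<forall>X\<in>Q. ?m \<in> X \<longrightarrow> Min X = ?m)}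
      = (\<Sum>P\<in>parts {1..?m}. if {?m} \<in> P then card P ^ n else 0)"
    unfolding card_partitions_min_le_such_that by (rule sum.cong[OF refl])
  also have "\<dots> = (\<Sum>P | P \<in> parts (insert ?m {1..k}) \<and> {?m} \<in> P. card P ^ n)"
    using finite_parts[of "{1..?m}"] by (simp add: sum.inter_filter[symmetric] atLeastAtMostSuc_conv)
  also have "\<dots> = (\<Sum>P\<in>parts {1..k}. card (insert {?m} P) ^ n)"
    by (rule sum.reindex_bij_betw[OF bij_insert_singleton, symmetric]) simp
  also have "\<dots> = (\<Sum>P\<in>parts {1..k}. Suc (card P) ^ n)"
  proof (rule sum.cong[OF refl])
    fix P assume P: "P \<in> parts {1..k}"
    then have "finite P" "{?m} \<notin> P" using finite_part[OF _ P] parts_block[OF P, of "{?m}"] by auto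
    then show "card (insert {?m} P) ^ n = Suc (card P) ^ n" by simp
  qed
  finally show ?thesis .
qed

text \<open>
  The new points must join all blocks except that of \<open>Suc k\<close>, which they must avoid. So the
  extensions correspond to surjections.
\<close>
lemma card_partitions_straddling:
  "card {Q. partition_on {1..Suc k + n} Q \<and> (\<forall>X\<in>Q. Min X \<le> Suc k) \<and>
      (\<forall>X\<in>Q. Suc k \<le> Max X) \<and> (\<forall>X\<in>Q. Suc k \<in> X \<longrightarrow> Max X = Suc k)}
    = (\<Sum>j\<le>k. fact j * Stirling (Suc k) (Suc j) * Stirling n j)"
proof -
  let ?m = "Suc k" and ?B = "{Suc (Suc k)..Suc k + n}"
  let ?F = "\<lambda>p. fact (p - 1) * Stirling n (p - 1)"
  have "card {f \<in> ?B \<rightarrow>\<^sub>E P. (\<forall>X\<in>extend_blocks ?B f P. ?m \<le> Max X) \<and>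
      (\<forall>X\<in>extend_blocks ?B f P. ?m \<in> X \<longrightarrow> Max X = ?m)} = ?F (card P)" (is "card ?L = _")
    if P: "P \<in> parts {1..?m}" for P
  proof -
    let ?D = "{X \<in> P. ?m \<notin> X}"
    note ex = extended_block_extrema[OF parts_block[OF P] refl, of _ n]
    have iff: "(\<forall>X\<in>extend_blocks ?B f P. ?m \<le> Max X) \<and> (\<forall>X\<in>extend_blocks ?B f P. ?m \<in> X \<longrightarrow> Max X = ?m)
        \<longleftrightarrow> (\<forall>X\<in>P. ?m \<in> X \<longleftrightarrow> X \<notin> f ` ?B)" for f
      unfolding ball_extend_blocks ball_conj_distrib[symmetric]
      by (intro ball_cong refl) (auto simp only: ex)
    have onto: "(\<forall>X\<in>P. ?m \<in> X \<longleftrightarrow> X \<notin> I) \<longleftrightarrow> I = ?D" if "I \<subseteq> P" for I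
      using that by blast
    have "?L = {f \<in> ?B \<rightarrow>\<^sub>E P. f ` ?B = ?D}"
    proof (intro Collect_cong conj_cong refl)
      fix f assume "f \<in> ?B \<rightarrow>\<^sub>E P"
      then have "f ` ?B \<subseteq> P" by blast
      then show "((\<forall>X\<in>extend_blocks ?B f P. ?m \<le> Max X) \<and>
          (\<forall>X\<in>extend_blocks ?B f P. ?m \<in> X \<longrightarrow> Max X = ?m)) = (f ` ?B = ?D)"
        unfolding iff by (rule onto)
    qed
    also have "\<dots> = {f \<in> ?B \<rightarrow>\<^sub>E ?D. f ` ?B = ?D}"
      by (rule Collect_cong) (unfold PiE_iff, blast)
    finally show ?thesis
      using card_surj[of ?B ?D] card_blocks_avoiding[OF _ P, of ?m] finite_part[OF _ P] by simp
  qed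
  then have "card {Q. partition_on {1..Suc k + n} Q \<and> (\<forall>X\<in>Q. Min X \<le> ?m) \<and>
      (\<forall>X\<in>Q. ?m \<le> Max X) \<and> (\<forall>X\<in>Q. ?m \<in> X \<longrightarrow> Max X = ?m)} = (\<Sum>P\<in>parts {1..?m}. ?F (card P))"
    unfolding card_partitions_min_le_such_that by (rule sum.cong[OF refl])
  also have "\<dots> = (\<Sum>j\<le>Suc k. Stirling (Suc k) j * ?F j)" by (rule sum_parts_Stirling)
  also have "\<dots> = (\<Sum>j\<le>k. fact j * Stirling (Suc k) (Suc j) * Stirling n j)"
    by (subst sum.atMost_Suc_shift) (simp add: ac_simps)
  finally show ?thesis .
qed

section \<open>Pairings of tableau counts\<close>

lemma level_weight_g_num:
  "level_weight (g_num (2 * k)) (B_num k)" "level_weight (g_num (2 * k + 1)) (B_tilde (Suc k))"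
proof -
  \<comment> \<open>the first coordinate of \<open>c\<close> is the length of the tableau, twice the index of the count\<close>
  define c where "c = (\<lambda>n j. if even n then B_num (n div 2) j else B_tilde (Suc (n div 2)) j)"
  have "level_weight (g_num n) (c n)" for n
    unfolding level_weight_def g_num_def simplified_eq_step_chains
  proof (intro allI impI, rule card_vac_chains)
    show "c (2 * k + 1) j = c (2 * k) j + Suc j * c (2 * k) (Suc j)" for k j
      using B_tilde_Suc[of k j] by (simp add: c_def)
    show "c (2 * k + 2) j = (if 0 \<in> {0, 1::nat} then c (2 * k + 1) j else 0)
        + (if j = 0 then 0 else c (2 * k + 1) (j - 1))" for k j
      using B_num_Suc[of k j] by (simp add: c_def)
  qed (simp_all add: c_def B_num_0)
  from this[of "2 * k"] this[of "2 * k + 1"]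
  show "level_weight (g_num (2 * k)) (B_num k)" "level_weight (g_num (2 * k + 1)) (B_tilde (Suc k))"
    by (simp_all add: c_def)
qed

lemma level_weight_a_num:
  "level_weight (a_num (2 * k)) (Stirling k)"
  "level_weight (a_num (2 * k + 1)) (\<lambda>j. Stirling (Suc k) (Suc j))"
proof -
  define c where "c = (\<lambda>n j. if even n then Stirling (n div 2) j else Stirling (Suc (n div 2)) (Suc j))"
  have "level_weight (a_num n) (c n)" for n
    unfolding level_weight_def a_num_def limiting_eq_step_chains
  proof (intro allI impI, rule card_vac_chains)
    show "c 0 j = (if j = 0 then 1 else 0)" for j by (cases j) (simp_all add: c_def)
    show "c (2 * k + 2) j = (if 0 \<in> {1::nat} then c (2 * k + 1) j else 0)
        + (if j = 0 then 0 else c (2 * k + 1) (j - 1))" for k j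
      by (cases j) (simp_all add: c_def)
  qed (simp_all add: c_def)
  from this[of "2 * k"] this[of "2 * k + 1"]
  show "level_weight (a_num (2 * k)) (Stirling k)"
    "level_weight (a_num (2 * k + 1)) (\<lambda>j. Stirling (Suc k) (Suc j))"
    by (simp_all add: c_def)
qed

lemma suminf_eq_sum_atMost:
  fixes h :: "nat \<Rightarrow> nat"
  assumes "\<And>j. j > N \<Longrightarrow> h j = 0"
  shows "(\<Sum>j. h j) = (\<Sum>j\<le>N. h j)"
  by (rule suminf_finite) (use assms in auto)

lemma pairing_a_num:
  assumes "level_weight G c"
  shows "(\<Sum>\<^sub>\<infinity>\<mu>\<in>Collect int_partition. G \<mu> * a_num (2 * n) \<mu>) = (\<Sum>j\<le>n. fact j * c j * Stirling n j)"
    and "(\<Sum>\<^sub>\<infinity>\<mu>\<in>Collect int_partition. G \<mu> * a_num (2 * n + 1) \<mu>)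
      = (\<Sum>j\<le>n. fact j * c j * Stirling (Suc n) (Suc j))"
  by (rule infsum_level_weight[OF assms level_weight_a_num(1)]; simp)
     (rule infsum_level_weight[OF assms level_weight_a_num(2)]; simp)

lemma suminf_Stirling:
  fixes c :: "nat \<Rightarrow> nat"
  shows "(\<Sum>j. fact j * c j * Stirling n j) = (\<Sum>j\<le>n. fact j * c j * Stirling n j)"
    and "(\<Sum>j. fact j * c j * Stirling (n + 1) (j + 1)) = (\<Sum>j\<le>n. fact j * c j * Stirling (Suc n) (Suc j))"
  by (simp_all add: suminf_eq_sum_atMost[of n])

text \<open>
  The Stirling numbers on both sides vanish beyond their first argument, so the sum over \<open>j\<close> may be cut
  off at \<open>n\<close>, as \<open>pairing_a_num\<close> does, or at \<open>k\<close>, as the count of set partitions does.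
\<close>
lemma pairing_a_half_a:
  "(\<Sum>\<^sub>\<infinity>\<mu>\<in>Collect int_partition. a_num (2 * k + 1) \<mu> * a_num (2 * n) \<mu>)
      = card {P. partition_on {1..k + n + 1} P \<and> (\<forall>X\<in>P. Min X \<le> k + 1 \<and> k + 1 \<le> Max X) \<and>
                 (\<forall>X\<in>P. k + 1 \<in> X \<longrightarrow> Max X = k + 1)} \<and>
   (\<Sum>\<^sub>\<infinity>\<mu>\<in>Collect int_partition. a_num (2 * k + 1) \<mu> * a_num (2 * n) \<mu>)
      = (\<Sum>j. fact j * Stirling (k + 1) (j + 1) * Stirling n j)"
proof -
  let ?s = "\<lambda>j. fact j * Stirling (k + 1) (j + 1) * Stirling n j :: nat"
  have sum: "(\<Sum>\<^sub>\<infinity>\<mu>\<in>Collect int_partition. a_num (2 * k + 1) \<mu> * a_num (2 * n) \<mu>) = (\<Sum>j. ?s j)"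
    using pairing_a_num(1)[OF level_weight_a_num(2), of k n] suminf_Stirling(1)[of "\<lambda>j. Stirling (Suc k) (Suc j)" n]
    by simp
  also have "\<dots> = (\<Sum>j\<le>k. ?s j)" by (rule suminf_eq_sum_atMost) simp
  also have "\<dots> = card {P. partition_on {1..k + n + 1} P \<and> (\<forall>X\<in>P. Min X \<le> k + 1 \<and> k + 1 \<le> Max X) \<and>
                 (\<forall>X\<in>P. k + 1 \<in> X \<longrightarrow> Max X = k + 1)}"
    using card_partitions_straddling[of k n] by (simp add: ball_conj_distrib conj_assoc)
  finally show ?thesis using sum by simp
qed

lemma pairing_g_a:
  "(\<Sum>\<^sub>\<infinity>\<mu>\<in>Collect int_partition. g_num (2 * k) \<mu> * a_num (2 * n) \<mu>)
      = card {P. partition_on {1..k + n} P \<and> (\<forall>X\<in>P. Min X \<le> k)} \<and>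
   (\<Sum>\<^sub>\<infinity>\<mu>\<in>Collect int_partition. g_num (2 * k) \<mu> * a_num (2 * n) \<mu>)
      = (\<Sum>j. fact j * B_num k j * Stirling n j)"
  unfolding pairing_a_num(1)[OF level_weight_g_num(1)] suminf_Stirling(1) sum_B_num_Stirling card_partitions_min_le
  by simp

lemma pairing_g_half_a_half:
  "(\<Sum>\<^sub>\<infinity>\<mu>\<in>Collect int_partition. g_num (2 * k + 1) \<mu> * a_num (2 * n + 1) \<mu>)
      = card {P. partition_on {1..Suc k + n} P \<and> (\<forall>X\<in>P. Min X \<le> Suc k)} \<and>
   (\<Sum>\<^sub>\<infinity>\<mu>\<in>Collect int_partition. g_num (2 * k + 1) \<mu> * a_num (2 * n + 1) \<mu>)
      = (\<Sum>j. fact j * B_tilde (Suc k) j * Stirling (n + 1) (j + 1))"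
  unfolding pairing_a_num(2)[OF level_weight_g_num(2)] suminf_Stirling(2) sum_B_tilde_Stirling_Suc card_partitions_min_le
  by simp

lemma pairing_g_half_a:
  "(\<Sum>\<^sub>\<infinity>\<mu>\<in>Collect int_partition. g_num (2 * k + 1) \<mu> * a_num (2 * n) \<mu>)
      = card {P. partition_on {1..k + n + 1} P \<and> (\<forall>X\<in>P. Min X \<le> k + 1) \<and>
                 (\<forall>X\<in>P. k + 1 \<in> X \<longrightarrow> Max X = k + 1)} \<and>
   (\<Sum>\<^sub>\<infinity>\<mu>\<in>Collect int_partition. g_num (2 * k + 1) \<mu> * a_num (2 * n) \<mu>)
      = (\<Sum>j. fact j * B_tilde (k + 1) j * Stirling n j)"
  unfolding pairing_a_num(1)[OF level_weight_g_num(2)] suminf_Stirling(1)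
  using card_partitions_max_in_block[of "Suc k" n] sum_B_tilde_Stirling[of k n] by simp

lemma pairing_g_a_half:
  "(\<Sum>\<^sub>\<infinity>\<mu>\<in>Collect int_partition. g_num (2 * k) \<mu> * a_num (2 * n + 1) \<mu>)
      = card {P. partition_on {1..k + n + 1} P \<and> (\<forall>X\<in>P. Min X \<le> k + 1) \<and>
                 (\<forall>X\<in>P. k + 1 \<in> X \<longrightarrow> Min X = k + 1)} \<and>
   (\<Sum>\<^sub>\<infinity>\<mu>\<in>Collect int_partition. g_num (2 * k) \<mu> * a_num (2 * n + 1) \<mu>)
      = (\<Sum>j. fact j * B_num k j * Stirling (n + 1) (j + 1))"
  unfolding pairing_a_num(2)[OF level_weight_g_num(1)] suminf_Stirling(2)
  using card_partitions_min_in_block[of k n] sum_B_num_Stirling_Suc[where k = k and n = n] by simp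

theorem corollary20:
  shows
    "(\<forall>k\<^sub>1 k\<^sub>2.
       (\<Sum>\<^sub>\<infinity>\<mu>\<in>Collect int_partition. a_num (2 * k\<^sub>1 + 1) \<mu> * a_num (2 * k\<^sub>2) \<mu>)
         = card {P. partition_on {1..k\<^sub>1 + k\<^sub>2 + 1} P \<and>
                    (\<forall>X\<in>P. Min X \<le> k\<^sub>1 + 1 \<and> k\<^sub>1 + 1 \<le> Max X) \<and>
                    (\<forall>X\<in>P. k\<^sub>1 + 1 \<in> X \<longrightarrow> Max X = k\<^sub>1 + 1)} \<and>
       (\<Sum>\<^sub>\<infinity>\<mu>\<in>Collect int_partition. a_num (2 * k\<^sub>1 + 1) \<mu> * a_num (2 * k\<^sub>2) \<mu>)
         = (\<Sum>j. fact j * Stirling (k\<^sub>1 + 1) (j + 1) * Stirling k\<^sub>2 j)) \<and>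
    (\<forall>k\<^sub>1 k\<^sub>2. k\<^sub>1 \<ge> 1 \<longrightarrow>
       (\<Sum>\<^sub>\<infinity>\<mu>\<in>Collect int_partition. g_num (2 * k\<^sub>1) \<mu> * a_num (2 * k\<^sub>2) \<mu>)
         = (\<Sum>\<^sub>\<infinity>\<mu>\<in>Collect int_partition. g_num (2 * k\<^sub>1 - 1) \<mu> * a_num (2 * k\<^sub>2 + 1) \<mu>) \<and>
       (\<Sum>\<^sub>\<infinity>\<mu>\<in>Collect int_partition. g_num (2 * k\<^sub>1 - 1) \<mu> * a_num (2 * k\<^sub>2 + 1) \<mu>)
         = card {P. partition_on {1..k\<^sub>1 + k\<^sub>2} P \<and> (\<forall>X\<in>P. Min X \<le> k\<^sub>1)} \<and>
       (\<Sum>\<^sub>\<infinity>\<mu>\<in>Collect int_partition. g_num (2 * k\<^sub>1 - 1) \<mu> * a_num (2 * k\<^sub>2 + 1) \<mu>)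
         = (\<Sum>j. fact j * B_num k\<^sub>1 j * Stirling k\<^sub>2 j) \<and>
       (\<Sum>j. fact j * B_num k\<^sub>1 j * Stirling k\<^sub>2 j)
         = (\<Sum>j. fact j * B_tilde k\<^sub>1 j * Stirling (k\<^sub>2 + 1) (j + 1))) \<and>
    (\<forall>k\<^sub>1 k\<^sub>2.
       (\<Sum>\<^sub>\<infinity>\<mu>\<in>Collect int_partition. g_num (2 * k\<^sub>1 + 1) \<mu> * a_num (2 * k\<^sub>2) \<mu>)
         = card {P. partition_on {1..k\<^sub>1 + k\<^sub>2 + 1} P \<and>
                    (\<forall>X\<in>P. Min X \<le> k\<^sub>1 + 1) \<and>
                    (\<forall>X\<in>P. k\<^sub>1 + 1 \<in> X \<longrightarrow> Max X = k\<^sub>1 + 1)} \<and>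
       (\<Sum>\<^sub>\<infinity>\<mu>\<in>Collect int_partition. g_num (2 * k\<^sub>1 + 1) \<mu> * a_num (2 * k\<^sub>2) \<mu>)
         = (\<Sum>j. fact j * B_tilde (k\<^sub>1 + 1) j * Stirling k\<^sub>2 j)) \<and>
    (\<forall>k\<^sub>1 k\<^sub>2.
       (\<Sum>\<^sub>\<infinity>\<mu>\<in>Collect int_partition. g_num (2 * k\<^sub>1) \<mu> * a_num (2 * k\<^sub>2 + 1) \<mu>)
         = card {P. partition_on {1..k\<^sub>1 + k\<^sub>2 + 1} P \<and>
                    (\<forall>X\<in>P. Min X \<le> k\<^sub>1 + 1) \<and>
                    (\<forall>X\<in>P. k\<^sub>1 + 1 \<in> X \<longrightarrow> Min X = k\<^sub>1 + 1)} \<and>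
       (\<Sum>\<^sub>\<infinity>\<mu>\<in>Collect int_partition. g_num (2 * k\<^sub>1) \<mu> * a_num (2 * k\<^sub>2 + 1) \<mu>)
         = (\<Sum>j. fact j * B_num k\<^sub>1 j * Stirling (k\<^sub>2 + 1) (j + 1)))"
proof (intro conjI allI impI)
  fix k\<^sub>1 k\<^sub>2 :: nat assume "k\<^sub>1 \<ge> 1"
  then obtain k where k: "k\<^sub>1 = Suc k" by (cases k\<^sub>1) auto
  note whole = pairing_g_a[of k\<^sub>1 k\<^sub>2] and half = pairing_g_half_a_half[of k k\<^sub>2]
  have odd: "2 * k\<^sub>1 - 1 = 2 * k + 1" using k by simp
  show "(\<Sum>\<^sub>\<infinity>\<mu>\<in>Collect int_partition. g_num (2 * k\<^sub>1) \<mu> * a_num (2 * k\<^sub>2) \<mu>)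
      = (\<Sum>\<^sub>\<infinity>\<mu>\<in>Collect int_partition. g_num (2 * k\<^sub>1 - 1) \<mu> * a_num (2 * k\<^sub>2 + 1) \<mu>)"
    and "(\<Sum>\<^sub>\<infinity>\<mu>\<in>Collect int_partition. g_num (2 * k\<^sub>1 - 1) \<mu> * a_num (2 * k\<^sub>2 + 1) \<mu>)
      = card {P. partition_on {1..k\<^sub>1 + k\<^sub>2} P \<and> (\<forall>X\<in>P. Min X \<le> k\<^sub>1)}"
    and "(\<Sum>\<^sub>\<infinity>\<mu>\<in>Collect int_partition. g_num (2 * k\<^sub>1 - 1) \<mu> * a_num (2 * k\<^sub>2 + 1) \<mu>)
      = (\<Sum>j. fact j * B_num k\<^sub>1 j * Stirling k\<^sub>2 j)"
    and "(\<Sum>j. fact j * B_num k\<^sub>1 j * Stirling k\<^sub>2 j)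
      = (\<Sum>j. fact j * B_tilde k\<^sub>1 j * Stirling (k\<^sub>2 + 1) (j + 1))"
    unfolding odd using whole half unfolding k by metis+
qed (use pairing_a_half_a pairing_g_half_a pairing_g_a_half in blast)+

end
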